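(* Let $k$ be an algebraically closed field of characteristic zero and let $I \subset S=k[x_0,\dots,x_n]$ be the homogeneous ideal of $s$ generic points of $\mathbb{P}^n_k$. Then for every term order $\tau$ on $S$ with $x_0>_\tau x_1>_\tau\cdots>_\tau x_n$, the generic initial ideal $\mathrm{gin}_\tau(I)$ is equal to the $\tau$-segment ideal $\mathrm{Seg}_\tau(I)$. In particular, $\mathrm{gin}_{\mathrm{lex}}(I)$ is a lex-segment ideal.
   Context: "$s$ generic points" means: there is a non-empty Zariski-open subset of $(\mathbb{P}^n)^s$ such that the conclusion (for all term orders $\tau$ simultaneously) holds for every $s$-tuple of points in it. All term orders are total well-orderings on monomials compatible with multiplication and assumed degree compatible ($m>n$ if $\deg m>\deg n$). For a homogeneous ideal $I$ and a term order $\tau$, $\mathrm{gin}_\tau(I)$ is the common value of $\mathrm{in}_\tau(g\cdot I)$ for $g$ in a suitable dense Zariski-open subset of $\mathrm{GL}_{n+1}(k)$. A vector space $V$ of forms of degree $d$ is a $\tau$-segment if it is spanned by monomials and, for every monomial $m\in V$ and every monomial $m'$ of degree $d$ with $m'>_\tau m$, one has $m'\in V$. For $0\le u\le\binom{n+d}{n}$, $\mathrm{Seg}_\tau(d,u)$ is the span of the $u$ largest monomials of degree $d$ with respect to $\tau$. For a homogeneous ideal $I$, $\mathrm{Seg}_\tau(I)=\bigoplus_d \mathrm{Seg}_\tau(d,\dim_k I_d)$, which in general is only a graded monomial vector space. A lex-segment ideal is an ideal each of whose graded components is a lex-segment, where lex is the degree-compatible lexicographic order with $x_0>\cdots>x_n$.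 *)

theory Defs
  imports
    "HOL-Analysis.Cartesian_Space"
    "HOL-Library.Poly_Mapping"
    "HOL-Computational_Algebra.Polynomial"
begin

section \<open>Polynomials in finitely many variables\<close>

text \<open>
  Variables are indexed by a finite type. For the ring \<open>S = k[x\<^sub>0, \<dots>, x\<^sub>n]\<close> the index type
  \<open>'n\<close> is moreover linearly ordered and has \<open>n + 1\<close> elements; its least element is the
  index of \<open>x\<^sub>0\<close> and its greatest one the index of \<open>x\<^sub>n\<close>. A monomial is its exponent vector.
  The ring operations are those of \<^theory>\<open>HOL-Library.Poly_Mapping\<close>.
\<close>

type_synonym 'n mon = "'n \<Rightarrow>\<^sub>0 nat"
type_synonym ('k, 'n) mpoly = "('n \<Rightarrow>\<^sub>0 nat) \<Rightarrow>\<^sub>0 'k"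

definition mdeg :: "'n::finite mon \<Rightarrow> nat" where
  "mdeg m = (\<Sum>i\<in>UNIV. Poly_Mapping.lookup m i)"

definition mon_poly :: "'n mon \<Rightarrow> ('k::comm_ring_1, 'n) mpoly" where
  "mon_poly m = Poly_Mapping.single m 1"

definition const :: "'k::comm_ring_1 \<Rightarrow> ('k, 'n) mpoly" where
  "const c = Poly_Mapping.single 0 c"

definition forms :: "nat \<Rightarrow> ('k::comm_ring_1, 'n::finite) mpoly set" where
  "forms d = {f. \<forall>m\<in>Poly_Mapping.keys f. mdeg m = d}"

text \<open>Substitute \<open>x i\<close> for the \<open>i\<close>-th variable, mapping coefficients by \<open>\<phi>\<close>.\<close>

definition subst :: "('k \<Rightarrow> 'b) \<Rightarrow> ('n::finite \<Rightarrow> 'b) \<Rightarrow> ('k::comm_ring_1, 'n) mpoly \<Rightarrow> 'b::comm_ring_1"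
  where "subst \<phi> x f = (\<Sum>m\<in>Poly_Mapping.keys f. \<phi> (Poly_Mapping.lookup f m) * (\<Prod>i\<in>UNIV. x i ^ Poly_Mapping.lookup m i))"

abbreviation meval :: "('n::finite \<Rightarrow> 'k) \<Rightarrow> ('k::comm_ring_1, 'n) mpoly \<Rightarrow> 'k" where
  "meval \<equiv> subst (\<lambda>c. c)"

global_interpretation mp: vector_space "\<lambda>(c::'k::field) (f::('k, 'n) mpoly). const c * f"
  defines mp_span = mp.span
    and mp_dim = mp.dim
  by unfold_locales
    (simp_all add: const_def distrib_left distrib_right single_add mult_single
      flip: mult.assoc)

global_interpretation mp_ideal:
  module "(*) :: ('k::comm_ring_1, 'n) mpoly \<Rightarrow> ('k, 'n) mpoly \<Rightarrow> ('k, 'n) mpoly"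
  defines ideal_span = mp_ideal.span
    and is_ideal = mp_ideal.subspace
  by unfold_locales (simp_all add: algebra_simps)

definition homogeneous_ideal :: "('k::comm_ring_1, 'n::finite) mpoly set \<Rightarrow> bool" where
  "homogeneous_ideal I \<longleftrightarrow> is_ideal I \<and> I = ideal_span (I \<inter> (\<Union>d. forms d))"

definition ideal_comp :: "('k::comm_ring_1, 'n::finite) mpoly set \<Rightarrow> nat \<Rightarrow> ('k, 'n) mpoly set" where
  "ideal_comp I d = I \<inter> forms d"


section \<open>Term orders and initial ideals\<close>

text \<open>
  A term order is given as a reflexive relation, \<open>(a, b) \<in> \<tau>\<close> meaning \<open>a \<le> b\<close>. Exponent
  vectors are added when monomials are multiplied.
\<close>

definition term_order :: "'n::finite mon rel \<Rightarrow> bool" where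
  "term_order \<tau> \<longleftrightarrow>
     well_order \<tau> \<and>
     (\<forall>a b c. (a, b) \<in> \<tau> \<longrightarrow> (a + c, b + c) \<in> \<tau>) \<and>
     (\<forall>a b. mdeg a < mdeg b \<longrightarrow> (a, b) \<in> \<tau>)"

definition mon_less :: "'n mon rel \<Rightarrow> 'n mon \<Rightarrow> 'n mon \<Rightarrow> bool" where
  "mon_less \<tau> a b \<longleftrightarrow> (a, b) \<in> \<tau> \<and> a \<noteq> b"

text \<open>\<open>x\<^sub>0 > x\<^sub>1 > \<dots> > x\<^sub>n\<close>\<close>

definition vars_decreasing :: "'n::linorder mon rel \<Rightarrow> bool" where
  "vars_decreasing \<tau> \<longleftrightarrow>
     (\<forall>i j. i < j \<longrightarrow> mon_less \<tau> (Poly_Mapping.single j 1) (Poly_Mapping.single i 1))"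

definition lex_order :: "'n::{finite,linorder} mon rel" where
  "lex_order = {(a, b). a = b \<or> mdeg a < mdeg b \<or>
     (mdeg a = mdeg b \<and> (\<exists>i. Poly_Mapping.lookup a i < Poly_Mapping.lookup b i \<and> (\<forall>j<i. Poly_Mapping.lookup a j = Poly_Mapping.lookup b j)))}"

definition lead_mon :: "'n mon rel \<Rightarrow> ('k::zero, 'n) mpoly \<Rightarrow> 'n mon" where
  "lead_mon \<tau> f = (THE m. m \<in> Poly_Mapping.keys f \<and> (\<forall>m'\<in>Poly_Mapping.keys f. (m', m) \<in> \<tau>))"

definition initial_ideal ::
  "'n mon rel \<Rightarrow> ('k::comm_ring_1, 'n) mpoly set \<Rightarrow> ('k, 'n) mpoly set" where
  "initial_ideal \<tau> I = ideal_span {mon_poly (lead_mon \<tau> f) |f. f \<in> I \<and> f \<noteq> 0}"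


section \<open>Generic initial ideals\<close>

text \<open>The linear change of coordinates \<open>x\<^sub>j \<mapsto> \<Sum>i. g\<^sub>i\<^sub>j x\<^sub>i\<close>.\<close>

definition gl_act :: "'k::comm_ring_1^'n^'n \<Rightarrow> ('k, 'n::finite) mpoly \<Rightarrow> ('k, 'n) mpoly" where
  "gl_act g = subst const (\<lambda>j. \<Sum>i\<in>UNIV. const (g $ i $ j) * mon_poly (Poly_Mapping.single i 1))"

text \<open>
  Allowing polynomials in the matrix entries only, rather than also inverse powers of the
  determinant, gives the same closed subsets of the general linear group.
\<close>

definition gl_open :: "('k::field^'n^'n) set \<Rightarrow> bool" where
  "gl_open U \<longleftrightarrow> (\<exists>F :: ('k, 'n \<times> 'n) mpoly set.
     U = {g. invertible g \<and> (\<exists>f\<in>F. meval (\<lambda>(i, j). g $ i $ j) f \<noteq> 0)})"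

definition gl_dense :: "('k::field^'n^'n) set \<Rightarrow> bool" where
  "gl_dense U \<longleftrightarrow> (\<forall>W. gl_open W \<and> W \<noteq> {} \<longrightarrow> U \<inter> W \<noteq> {})"

definition is_gin ::
  "'n::finite mon rel \<Rightarrow> ('k::field, 'n) mpoly set \<Rightarrow> ('k, 'n) mpoly set \<Rightarrow> bool" where
  "is_gin \<tau> I J \<longleftrightarrow>
     (\<exists>U. gl_open U \<and> gl_dense U \<and> (\<forall>g\<in>U. initial_ideal \<tau> (gl_act g ` I) = J))"

definition gin :: "'n::finite mon rel \<Rightarrow> ('k::field, 'n) mpoly set \<Rightarrow> ('k, 'n) mpoly set" where
  "gin \<tau> I = (THE J. is_gin \<tau> I J)"

lemma is_gin_unique:
  fixes I :: "('a::field, 'b::finite) mpoly set"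
  assumes "is_gin \<tau> I J" "is_gin \<tau> I J'"
  shows "J = J'"
proof -
  obtain U where U: "gl_open U" "gl_dense U" "\<forall>g\<in>U. initial_ideal \<tau> (gl_act g ` I) = J"
    using assms(1) unfolding is_gin_def by blast
  obtain U' where U': "gl_open U'" "gl_dense U'" "\<forall>g\<in>U'. initial_ideal \<tau> (gl_act g ` I) = J'"
    using assms(2) unfolding is_gin_def by blast
  have "meval x (1 :: ('a, 'b \<times> 'b) mpoly) \<noteq> 0" for x :: "'b \<times> 'b \<Rightarrow> 'a"
    by (simp add: subst_def)
  then have "{g. invertible g} =
      {g. invertible g \<and> (\<exists>f\<in>{1 :: ('a, 'b \<times> 'b) mpoly}. meval (\<lambda>(i, j). g $ i $ j) f \<noteq> 0)}"
    by simp
  then have "gl_open {g :: 'a^'b^'b. invertible g}"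
    unfolding gl_open_def by blast
  moreover have "mat 1 \<in> {g :: 'a^'b^'b. invertible g}"
    by (simp add: invertible_def)
  ultimately have "U' \<noteq> {}"
    using U'(2) unfolding gl_dense_def by blast
  then have "U \<inter> U' \<noteq> {}"
    using U(2) U'(1) unfolding gl_dense_def by blast
  then show ?thesis
    using U(3) U'(3) by blast
qed

lemma gin_eqI: "is_gin \<tau> I J \<Longrightarrow> gin \<tau> I = J"
  unfolding gin_def by (rule the_equality, assumption, rule is_gin_unique)


section \<open>Segments\<close>

definition is_segment :: "'n::finite mon rel \<Rightarrow> nat \<Rightarrow> ('k::field, 'n) mpoly set \<Rightarrow> bool" where
  "is_segment \<tau> d V \<longleftrightarrow>
     (\<exists>M \<subseteq> {m. mdeg m = d}. V = mp_span (mon_poly ` M)) \<and>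
     (\<forall>m m'. mon_poly m \<in> V \<and> mdeg m' = d \<and> mon_less \<tau> m m' \<longrightarrow> mon_poly m' \<in> V)"

definition segment_ideal :: "'n::finite mon rel \<Rightarrow> ('k::field, 'n) mpoly set \<Rightarrow> bool" where
  "segment_ideal \<tau> I \<longleftrightarrow> homogeneous_ideal I \<and> (\<forall>d. is_segment \<tau> d (ideal_comp I d))"

text \<open>
  A monomial is among the \<open>u\<close> largest ones of its degree iff fewer than \<open>u\<close> monomials of that
  degree exceed it.
\<close>

definition Seg :: "'n::finite mon rel \<Rightarrow> nat \<Rightarrow> nat \<Rightarrow> ('k::field, 'n) mpoly set" where
  "Seg \<tau> d u = mp_span (mon_poly ` {m. mdeg m = d \<and> card {m'. mdeg m' = d \<and> mon_less \<tau> m m'} < u})"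

definition Seg_ideal :: "'n::finite mon rel \<Rightarrow> ('k::field, 'n) mpoly set \<Rightarrow> ('k, 'n) mpoly set" where
  "Seg_ideal \<tau> I = mp_span (\<Union>d. Seg \<tau> d (mp_dim (ideal_comp I d)))"


section \<open>Points of projective space\<close>

text \<open>Points are the lines through the origin of \<open>k\<^bsup>n+1\<^esup>\<close>.\<close>

typedef (overloaded) ('k, 'n) proj = "{L :: ('k::field^'n::finite) set. \<exists>v. v \<noteq> 0 \<and> L = vec.span {v}}"
proof -
  have "(1 :: 'k^'n) \<noteq> 0"
    by (simp add: vec_eq_iff)
  then show ?thesis
    by blast
qed

definition hom_coords :: "('k::field, 'n::finite) proj \<Rightarrow> ('k^'n) set" where
  "hom_coords p = Rep_proj p - {0}"

text \<open>
  An \<open>s\<close>-tuple of points is a function from a type \<open>'s\<close> with \<open>s\<close> elements. The Zariski topology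
  on \<open>(\<P>\<^sup>n)\<^sup>s\<close> is cut out by multihomogeneous polynomials in variables indexed by \<open>'s \<times> 'n\<close>.
\<close>

definition multihomogeneous :: "('k::field, 's::finite \<times> 'n::finite) mpoly \<Rightarrow> bool" where
  "multihomogeneous f \<longleftrightarrow>
     (\<exists>e. \<forall>m\<in>Poly_Mapping.keys f. \<forall>i. (\<Sum>j\<in>UNIV. Poly_Mapping.lookup m (i, j)) = e i)"

definition mvanishes ::
  "('k::field, 's::finite \<times> 'n::finite) mpoly \<Rightarrow> ('s \<Rightarrow> ('k, 'n) proj) \<Rightarrow> bool" where
  "mvanishes f P \<longleftrightarrow>
     (\<forall>v. (\<forall>i. v i \<in> hom_coords (P i)) \<longrightarrow> meval (\<lambda>(i, j). v i $ j) f = 0)"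

definition zariski_open :: "('s::finite \<Rightarrow> ('k::field, 'n::finite) proj) set \<Rightarrow> bool" where
  "zariski_open U \<longleftrightarrow>
     (\<exists>F. (\<forall>f\<in>F. multihomogeneous f) \<and> U = {P. \<exists>f\<in>F. \<not> mvanishes f P})"

definition points_ideal :: "('s::finite \<Rightarrow> ('k::field, 'n::finite) proj) \<Rightarrow> ('k, 'n) mpoly set" where
  "points_ideal P = ideal_span
     {f. (\<exists>d. f \<in> forms d) \<and> (\<forall>i. \<forall>v\<in>hom_coords (P i). meval (($) v) f = 0)}"

end

theory Submission
  imports Defs "HOL-Analysis.Determinants"
begin

text \<open>
  Let \<open>w\<^sub>1, \<dots>, w\<^sub>s\<close> be points and \<open>J\<close> the ideal of polynomials vanishing on them. Call the \<open>s\<close> smallest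
  monomials of each degree low and all others high. Suppose that in each degree the low monomials
  are linearly independent as functions on the points. Then no nonzero form in \<open>J\<close> consists of low
  monomials only, so every leading monomial of \<open>J\<close> is high. Conversely, if there is a high monomial
  of degree \<open>d\<close>, then there are exactly \<open>s\<close> low ones; they interpolate arbitrary values on the points,
  and every high monomial can be corrected by low ones to an element of \<open>J\<close>. So the leading
  monomials of \<open>J\<close> are exactly the high ones (\<open>lead_mons_vanishing_ideal\<close>), which form a segment in
  each degree and are closed under multiplication. Their number in degree \<open>d\<close> is the dimension of
  \<open>J\<^sub>d\<close> (\<open>dim_vanishing_forms\<close>). Hence the initial ideal of \<open>J\<close> is its segment ideal.

  It remains to see that independence holds for generic points and is kept by a generic change of
  coordinates. Distinct monomials are independent functions, by Dedekind's argument on characters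
  (\<open>monomial_functions_independent\<close>), so at most \<open>s\<close> monomials are independent on suitable \<open>s\<close> points,
  and a minor of the evaluation matrix expresses this by a multihomogeneous polynomial. Finitely
  many degrees are enough: a monomial of degree \<open>d\<close> without the smallest variable has at least \<open>d\<close>
  smaller monomials of its degree, so from degree \<open>s\<close> on all low monomials are multiples, by the
  smallest variable, of low monomials of the preceding degree
  (\<open>low_mons_divisible_by_last\<close>, \<open>indep_on_low_mons_all_degrees\<close>). Treating all sets of at most \<open>s\<close>
  monomials of a degree \<open>d \<le> s\<close> at once gives one polynomial \<open>F\<close> that serves every term order
  (\<open>generic_points_polynomial\<close>). Nonzero polynomials have nonzero products because an affine space
  over an infinite field is irreducible (\<open>poly_fun_common_nonzero\<close>).

  Finally, a change of coordinates by \<open>g\<close> replaces each point \<open>v\<close> by \<open>v g\<^sup>-\<^sup>1\<close>, which up to a factor is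
  polynomial in \<open>g\<close>. For points with \<open>F \<noteq> 0\<close> the matrices for which the moved points still satisfy
  \<open>F \<noteq> 0\<close> form an open set containing the identity, hence a dense one, and on it the initial ideal is
  the segment ideal computed above (\<open>is_gin_vanishing_ideal\<close>).
\<close>

section \<open>Evaluation of polynomials\<close>

definition mon_eval :: "('v::finite \<Rightarrow> 'b) \<Rightarrow> 'v mon \<Rightarrow> 'b::comm_ring_1" where
  "mon_eval x m = (\<Prod>i\<in>UNIV. x i ^ Poly_Mapping.lookup m i)"

lemma mon_eval_add: "mon_eval x (a + b) = mon_eval x a * mon_eval x b"
  by (simp add: mon_eval_def lookup_add power_add prod.distrib)

lemma mon_eval_zero [simp]: "mon_eval x 0 = 1"
  by (simp add: mon_eval_def)

lemma mon_eval_single [simp]: "mon_eval x (Poly_Mapping.single v k) = x v ^ k"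
proof -
  have "mon_eval x (Poly_Mapping.single v k) = (\<Prod>i\<in>UNIV. if i = v then x i ^ k else 1)"
    unfolding mon_eval_def by (intro prod.cong) (auto simp: lookup_single when_def)
  then show ?thesis
    by simp
qed

lemma mon_eval_mult: "mon_eval (\<lambda>j. x j * y j) m = mon_eval x m * mon_eval y m"
  by (simp add: mon_eval_def power_mult_distrib prod.distrib)

lemma mon_eval_scale: "mon_eval (\<lambda>j. t * x j) m = t ^ mdeg m * mon_eval x m"
  by (simp add: mon_eval_def mdeg_def power_mult_distrib prod.distrib power_sum)

lemma mdeg_add: "mdeg (a + b) = mdeg a + mdeg b"
  by (simp add: mdeg_def lookup_add sum.distrib)

lemma mdeg_single [simp]: "mdeg (Poly_Mapping.single v k) = k"
proof -
  have "mdeg (Poly_Mapping.single v k) = (\<Sum>i\<in>UNIV. if i = v then k else 0)"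
    unfolding mdeg_def by (intro sum.cong) (auto simp: lookup_single when_def)
  then show ?thesis
    by simp
qed

lemma finite_mdeg: "finite {m :: 'n::finite mon. mdeg m = d}"
proof (rule finite_imageD)
  have "Poly_Mapping.lookup m i \<le> mdeg m" for m :: "'n mon" and i
    unfolding mdeg_def by (rule member_le_sum) simp_all
  then have "Poly_Mapping.lookup ` {m :: 'n mon. mdeg m = d} \<subseteq> UNIV \<rightarrow>\<^sub>E {..d}"
    by (auto simp: PiE_def)
  moreover have "finite ((UNIV :: 'n set) \<rightarrow>\<^sub>E {..d})"
    by (rule finite_PiE) simp_all
  ultimately show "finite (Poly_Mapping.lookup ` {m :: 'n mon. mdeg m = d})"
    by (rule finite_subset)
  show "inj_on Poly_Mapping.lookup {m :: 'n mon. mdeg m = d}"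
    by (simp add: inj_on_def)
qed

lemma mpoly_eq_sum_single:
  "f = (\<Sum>m\<in>Poly_Mapping.keys f. Poly_Mapping.single m (Poly_Mapping.lookup f m))"
proof (rule poly_mapping_eqI)
  fix k
  have "(\<Sum>m\<in>Poly_Mapping.keys f. Poly_Mapping.lookup
          (Poly_Mapping.single m (Poly_Mapping.lookup f m)) k) =
        (\<Sum>m\<in>Poly_Mapping.keys f. if m = k then Poly_Mapping.lookup f m else 0)"
    by (intro sum.cong) (auto simp: lookup_single when_def)
  then show "Poly_Mapping.lookup f k = Poly_Mapping.lookup
      (\<Sum>m\<in>Poly_Mapping.keys f. Poly_Mapping.single m (Poly_Mapping.lookup f m)) k"
    by (simp add: lookup_sum in_keys_iff)
qed

lemma meval_eq_sum_superset:
  assumes "finite A" "Poly_Mapping.keys f \<subseteq> A"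
  shows "meval x f = (\<Sum>m\<in>A. Poly_Mapping.lookup f m * mon_eval x m)"
  unfolding subst_def mon_eval_def
  by (rule sum.mono_neutral_left) (use assms in \<open>auto simp: in_keys_iff\<close>)

lemma meval_add: "meval x (f + g) = meval x f + meval x g"
proof -
  let ?A = "Poly_Mapping.keys f \<union> Poly_Mapping.keys g"
  show ?thesis
    using meval_eq_sum_superset[of ?A f x] meval_eq_sum_superset[of ?A g x]
      meval_eq_sum_superset[of ?A "f + g" x] keys_add[of f g]
    by (simp add: lookup_add distrib_right sum.distrib)
qed

lemma meval_single [simp]: "meval x (Poly_Mapping.single m c) = c * mon_eval x m"
  using meval_eq_sum_superset[of "{m}" "Poly_Mapping.single m c" x] by simp

lemma meval_zero [simp]: "meval x 0 = 0"
  by (simp add: subst_def)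

lemma meval_sum: "meval x (sum f A) = (\<Sum>a\<in>A. meval x (f a))"
  by (induction A rule: infinite_finite_induct) (simp_all add: meval_add)

lemma meval_mult: "meval x (f * g) = meval x f * meval x g"
proof -
  let ?s = "\<lambda>f :: ('a, 'b) mpoly. \<lambda>m. Poly_Mapping.single m (Poly_Mapping.lookup f m)"
  have "f * g = (\<Sum>a\<in>Poly_Mapping.keys f. \<Sum>b\<in>Poly_Mapping.keys g. ?s f a * ?s g b)"
    by (subst mpoly_eq_sum_single[of f], subst mpoly_eq_sum_single[of g]) (simp add: sum_product)
  then have "meval x (f * g) = (\<Sum>a\<in>Poly_Mapping.keys f. \<Sum>b\<in>Poly_Mapping.keys g.
      meval x (?s f a) * meval x (?s g b))"
    by (simp add: meval_sum mult_single mon_eval_add ac_simps)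
  also have "\<dots> = meval x f * meval x g"
    by (simp add: sum_product[symmetric] meval_sum[symmetric] mpoly_eq_sum_single[symmetric]
        del: meval_single)
  finally show ?thesis .
qed

lemma meval_one [simp]: "meval x 1 = 1"
  using meval_single[of x 0 1] by simp

lemma meval_const [simp]: "meval x (const c) = c"
  by (simp add: const_def)

lemma meval_mon_poly [simp]: "meval x (mon_poly m) = mon_eval x m"
  by (simp add: mon_poly_def)

lemma meval_prod: "meval x (prod f A) = (\<Prod>a\<in>A. meval x (f a))"
  by (induction A rule: infinite_finite_induct) (simp_all add: meval_mult)

lemma meval_power: "meval x (f ^ k) = meval x f ^ k"
  by (induction k) (simp_all add: meval_mult)

lemma meval_diff: "meval x (f - g) = meval x f - meval x g"
  using meval_add[of x "f - g" g] by simp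

lemma meval_subst_const: "meval x (subst const y f) = meval (\<lambda>j. meval x (y j)) f"
  by (simp add: subst_def[of const] subst_def[of "\<lambda>c. c" _ f] meval_sum meval_mult meval_prod
      meval_power)

text \<open>On points, the substitution \<open>gl_act g\<close> is the row vector \<open>x\<close> turned into \<open>x g\<close>. This is what
  moves the points of a vanishing ideal by the inverse of \<open>g\<close>.\<close>

lemma meval_gl_act: "meval x (gl_act g f) = meval (\<lambda>j. \<Sum>i\<in>UNIV. x i * g $ i $ j) f"
  unfolding gl_act_def meval_subst_const
  by (simp add: meval_sum meval_mult mult.commute)

text \<open>Dedekind's argument: distinct monomials are distinct multiplicative characters of \<open>k\<^sup>n\<close>.
  They are told apart by the points with one coordinate 2 and all others 1, since 2 has
  infinite multiplicative order in characteristic zero.\<close>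

lemma monomial_functions_independent:
  fixes c :: "'v::finite mon \<Rightarrow> 'k::field_char_0"
  assumes "finite M" "\<And>x. (\<Sum>m\<in>M. c m * mon_eval x m) = 0" "m \<in> M"
  shows "c m = 0"
  using assms
proof (induction M arbitrary: c m rule: finite_induct)
  case (insert a M)
  have M: "c b = 0" if b: "b \<in> M" for b
  proof -
    \<comment> \<open>Subtract \<open>mon_eval y a\<close> times the relation at \<open>x\<close> from the relation at the product of
      \<open>x\<close> and \<open>y\<close>: the term at \<open>a\<close> cancels.\<close>
    have *: "c b' * (mon_eval y b' - mon_eval y a) = 0" if "b' \<in> M" for b' y
    proof (rule insert.IH[OF _ that])
      fix x
      have 1: "(\<Sum>m\<in>insert a M. c m * mon_eval (\<lambda>j. x j * y j) m) = 0"
        "mon_eval y a * (\<Sum>m\<in>insert a M. c m * mon_eval x m) = 0"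
        using insert.prems(1) by simp_all
      have "(\<Sum>b\<in>M. c b * (mon_eval y b - mon_eval y a) * mon_eval x b)
        = (\<Sum>m\<in>insert a M. c m * mon_eval (\<lambda>j. x j * y j) m)
          - mon_eval y a * (\<Sum>m\<in>insert a M. c m * mon_eval x m)"
        using insert.hyps
        by (simp add: mon_eval_mult algebra_simps sum_distrib_left sum_subtractf)
      then show "(\<Sum>b\<in>M. c b * (mon_eval y b - mon_eval y a) * mon_eval x b) = 0"
        using 1 by simp
    qed
    have "b \<noteq> a"
      using b insert.hyps by blast
    then obtain i where i: "Poly_Mapping.lookup b i \<noteq> Poly_Mapping.lookup a i"
      by (metis poly_mapping_eqI)
    define y :: "'v \<Rightarrow> 'k" where "y = (\<lambda>j. if j = i then 2 else 1)"
    have y: "mon_eval y m = 2 ^ Poly_Mapping.lookup m i" for m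
    proof -
      have "mon_eval y m = (\<Prod>j\<in>UNIV. if j = i then 2 ^ Poly_Mapping.lookup m j else 1)"
        unfolding mon_eval_def y_def by (intro prod.cong) auto
      then show ?thesis
        by simp
    qed
    have "(2::'k) ^ p = 2 ^ q \<longleftrightarrow> p = q" for p q
    proof -
      have "(2::'k) ^ p = 2 ^ q \<longleftrightarrow> (of_nat (2 ^ p) :: 'k) = of_nat (2 ^ q)"
        by simp
      then show ?thesis
        by (simp only: of_nat_eq_iff) simp
    qed
    then have "mon_eval y b \<noteq> mon_eval y a"
      using i y by simp
    then show ?thesis
      using *[OF b, of y] by simp
  qed
  have "c a = 0"
    using insert.prems(1)[of "\<lambda>_. 1"] insert.hyps M by (simp add: mon_eval_def)
  then show ?case
    using M insert.prems(2) by blast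
qed simp

lemma meval_eq_zero_imp_zero:
  fixes f :: "('k::field_char_0, 'v::finite) mpoly"
  assumes "\<And>x. meval x f = 0"
  shows "f = 0"
proof (rule poly_mapping_eqI)
  fix m
  have "Poly_Mapping.lookup f m = 0" if "m \<in> Poly_Mapping.keys f"
    by (rule monomial_functions_independent[OF finite_keys _ that])
      (use assms in \<open>simp add: meval_eq_sum_superset[OF finite_keys order_refl]\<close>)
  then show "Poly_Mapping.lookup f m = Poly_Mapping.lookup 0 m"
    by (auto simp: in_keys_iff)
qed

section \<open>Polynomial functions\<close>

text \<open>Polynomials are handled through the functions they define, so that determinants and
  substitutions need no separate calculation with coefficients. The set \<open>D\<close> of admissible monomials
  keeps track of the multidegree; it is \<open>UNIV\<close> where the degree is irrelevant.\<close>

definition poly_fun :: "'v mon set \<Rightarrow> (('v::finite \<Rightarrow> 'k::comm_ring_1) \<Rightarrow> 'k) \<Rightarrow> bool" where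
  "poly_fun D \<phi> \<longleftrightarrow> (\<exists>f. Poly_Mapping.keys f \<subseteq> D \<and> (\<forall>x. \<phi> x = meval x f))"

lemma poly_fun_meval: "Poly_Mapping.keys f \<subseteq> D \<Longrightarrow> poly_fun D (\<lambda>x. meval x f)"
  unfolding poly_fun_def by blast

lemma poly_fun_mono: "poly_fun D \<phi> \<Longrightarrow> D \<subseteq> E \<Longrightarrow> poly_fun E \<phi>"
  unfolding poly_fun_def by blast

lemma poly_fun_const: "0 \<in> D \<Longrightarrow> poly_fun D (\<lambda>x. c)"
  using poly_fun_meval[of "const c" D] by (simp add: const_def)

lemma poly_fun_zero: "poly_fun D (\<lambda>x. 0)"
  using poly_fun_meval[of 0 D] by simp

lemma poly_fun_mon_eval: "m \<in> D \<Longrightarrow> poly_fun D (\<lambda>x. mon_eval x m)"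
  using poly_fun_meval[of "mon_poly m" D] by (simp add: mon_poly_def)

lemma poly_fun_coord: "poly_fun UNIV (\<lambda>x. x v)"
  using poly_fun_mon_eval[of "Poly_Mapping.single v 1" UNIV] by simp

lemma poly_fun_add:
  assumes "poly_fun D \<phi>" "poly_fun D \<psi>"
  shows "poly_fun D (\<lambda>x. \<phi> x + \<psi> x)"
proof -
  obtain f g where "Poly_Mapping.keys f \<subseteq> D" "Poly_Mapping.keys g \<subseteq> D"
    "\<And>x. \<phi> x = meval x f" "\<And>x. \<psi> x = meval x g"
    using assms unfolding poly_fun_def by blast
  moreover from this have "Poly_Mapping.keys (f + g) \<subseteq> D"
    using keys_add[of f g] by blast
  ultimately show ?thesis
    using poly_fun_meval[of "f + g" D] by (simp add: meval_add)
qed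

lemma poly_fun_mult:
  assumes "poly_fun D \<phi>" "poly_fun E \<psi>" "\<And>a b. a \<in> D \<Longrightarrow> b \<in> E \<Longrightarrow> a + b \<in> H"
  shows "poly_fun H (\<lambda>x. \<phi> x * \<psi> x)"
proof -
  obtain f g where "Poly_Mapping.keys f \<subseteq> D" "Poly_Mapping.keys g \<subseteq> E"
    "\<And>x. \<phi> x = meval x f" "\<And>x. \<psi> x = meval x g"
    using assms unfolding poly_fun_def by blast
  then show ?thesis
    using poly_fun_meval[of "f * g" H] keys_mult[of f g] assms(3)
    by (force simp: meval_mult)
qed

lemma poly_fun_sum: "(\<And>a. a \<in> A \<Longrightarrow> poly_fun D (\<phi> a)) \<Longrightarrow> poly_fun D (\<lambda>x. \<Sum>a\<in>A. \<phi> a x)"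
  by (induction A rule: infinite_finite_induct) (auto intro: poly_fun_add poly_fun_zero)

lemma poly_fun_scale: "poly_fun D \<phi> \<Longrightarrow> poly_fun D (\<lambda>x. c * \<phi> x)"
  using poly_fun_mult[OF poly_fun_const[of "{0}"], of D \<phi> D] by simp

lemma poly_fun_UNIV_mult:
  "poly_fun UNIV \<phi> \<Longrightarrow> poly_fun UNIV \<psi> \<Longrightarrow> poly_fun UNIV (\<lambda>x. \<phi> x * \<psi> x)"
  by (erule (1) poly_fun_mult) simp

lemma poly_fun_UNIV_power: "poly_fun UNIV \<phi> \<Longrightarrow> poly_fun UNIV (\<lambda>x. \<phi> x ^ k)"
  by (induction k) (auto intro: poly_fun_UNIV_mult poly_fun_const)

lemma poly_fun_UNIV_prod:
  "(\<And>a. a \<in> A \<Longrightarrow> poly_fun UNIV (\<phi> a)) \<Longrightarrow> poly_fun UNIV (\<lambda>x. \<Prod>a\<in>A. \<phi> a x)"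
  by (induction A rule: infinite_finite_induct) (auto intro: poly_fun_UNIV_mult poly_fun_const)

lemma poly_fun_compose:
  assumes "poly_fun D \<phi>" "\<And>v. poly_fun UNIV (\<psi> v)"
  shows "poly_fun UNIV (\<lambda>x. \<phi> (\<lambda>v. \<psi> v x))"
proof -
  obtain f where f: "\<And>x. \<phi> x = meval x f"
    using assms(1) unfolding poly_fun_def by blast
  show ?thesis
    unfolding f subst_def
    by (intro poly_fun_sum poly_fun_scale poly_fun_UNIV_prod poly_fun_UNIV_power assms(2))
qed

lemma poly_fun_det:
  assumes "\<And>p. p permutes UNIV \<Longrightarrow> poly_fun D (\<lambda>x. \<Prod>i\<in>UNIV. A x $ i $ p i)"
  shows "poly_fun D (\<lambda>x. det (A x))"
  unfolding det_def using assms by (intro poly_fun_sum poly_fun_scale) auto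

lemma poly_fun_UNIV_det:
  "(\<And>i j. poly_fun UNIV (\<lambda>x. A x $ i $ j)) \<Longrightarrow> poly_fun UNIV (\<lambda>x. det (A x))"
  by (intro poly_fun_det poly_fun_UNIV_prod)

lemma poly_fun_on_line:
  assumes "poly_fun D \<phi>"
  shows "\<exists>p :: 'k::field poly. \<forall>t. \<phi> (\<lambda>v. x v + t * y v) = poly p t"
proof -
  obtain f where f: "\<And>x. \<phi> x = meval x f"
    using assms unfolding poly_fun_def by blast
  define p where "p = (\<Sum>m\<in>Poly_Mapping.keys f.
      [:Poly_Mapping.lookup f m:] * (\<Prod>v\<in>UNIV. [:x v, y v:] ^ Poly_Mapping.lookup m v))"
  have "\<phi> (\<lambda>v. x v + t * y v) = poly p t" for t
    unfolding f subst_def p_def by (simp add: poly_sum poly_prod poly_power)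
  then show ?thesis
    by (intro exI allI)
qed

text \<open>Affine space over an infinite field is irreducible: restrict both functions to the line
  through the two given points, where they become nonzero polynomials in one variable.\<close>

lemma poly_fun_common_nonzero:
  fixes x y :: "'v::finite \<Rightarrow> 'k::field_char_0"
  assumes "poly_fun D \<phi>" "poly_fun E \<psi>" "\<phi> x \<noteq> 0" "\<psi> y \<noteq> 0"
  shows "\<exists>z. \<phi> z \<noteq> 0 \<and> \<psi> z \<noteq> 0"
proof -
  let ?l = "\<lambda>t v. x v + t * (y v - x v)"
  obtain p where p: "\<forall>t. \<phi> (?l t) = poly p t"
    using poly_fun_on_line[OF assms(1), of x "\<lambda>v. y v - x v"] ..
  obtain q where q: "\<forall>t. \<psi> (?l t) = poly q t"
    using poly_fun_on_line[OF assms(2), of x "\<lambda>v. y v - x v"] ..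
  have "poly p 0 \<noteq> 0" "poly q 1 \<noteq> 0"
    using assms(3,4) p[rule_format, of 0, symmetric] q[rule_format, of 1, symmetric] by simp_all
  then have "p * q \<noteq> 0"
    by (metis mult_eq_0_iff poly_0)
  then have "finite {t. poly (p * q) t = 0}"
    by (rule poly_roots_finite)
  then obtain t where "poly (p * q) t \<noteq> 0"
    using ex_new_if_finite[OF infinite_UNIV_char_0[where 'a='k]] by blast
  then show ?thesis
    using p q by (intro exI[of _ "?l t"]) simp
qed

lemma poly_fun_prod_nonzero_somewhere:
  fixes \<phi> :: "'a \<Rightarrow> ('v::finite \<Rightarrow> 'k::field_char_0) \<Rightarrow> 'k"
  assumes "finite K" "\<And>a. a \<in> K \<Longrightarrow> poly_fun UNIV (\<phi> a)" "\<And>a. a \<in> K \<Longrightarrow> \<exists>x. \<phi> a x \<noteq> 0"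
  shows "\<exists>x. (\<Prod>a\<in>K. \<phi> a x) \<noteq> 0"
  using assms
proof (induction K rule: finite_induct)
  case (insert a K)
  have "\<exists>y. (\<Prod>a\<in>K. \<phi> a y) \<noteq> 0"
    by (rule insert.IH) (simp_all add: insert.prems)
  then obtain y where y: "(\<Prod>a\<in>K. \<phi> a y) \<noteq> 0"
    by (rule exE)
  obtain x where x: "\<phi> a x \<noteq> 0"
    by (rule exE[OF insert.prems(2)[of a]]) simp_all
  have "\<exists>z. \<phi> a z \<noteq> 0 \<and> (\<Prod>a\<in>K. \<phi> a z) \<noteq> 0"
    by (rule poly_fun_common_nonzero[of UNIV "\<phi> a" UNIV "\<lambda>x. \<Prod>a\<in>K. \<phi> a x" x y])
      (simp_all add: insert.prems poly_fun_UNIV_prod x y)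
  then show ?case
    using insert.hyps by simp
qed simp

section \<open>Multihomogeneous polynomial functions\<close>

definition multidegree :: "('s \<Rightarrow> nat) \<Rightarrow> ('s \<times> 'n::finite) mon set" where
  "multidegree e = {m. \<forall>i. (\<Sum>j\<in>UNIV. Poly_Mapping.lookup m (i, j)) = e i}"

lemma zero_in_multidegree [simp]: "0 \<in> multidegree (\<lambda>i. 0)"
  by (simp add: multidegree_def)

lemma multidegree_add:
  "a \<in> multidegree e \<Longrightarrow> b \<in> multidegree e' \<Longrightarrow> a + b \<in> multidegree (\<lambda>i. e i + e' i)"
  by (simp add: multidegree_def lookup_add sum.distrib)

lemma single_in_multidegree:
  "Poly_Mapping.single (i, j) k \<in> multidegree (\<lambda>i'. if i' = i then k else 0)"
proof -
  have "(\<Sum>j'\<in>UNIV. Poly_Mapping.lookup (Poly_Mapping.single (i, j) k) (i', j')) =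
      (\<Sum>j'\<in>UNIV. if j' = j then (if i' = i then k else 0) else 0)" for i'
    by (intro sum.cong) (auto simp: lookup_single when_def)
  then show ?thesis
    by (simp add: multidegree_def)
qed

lemma poly_fun_multidegree_prod:
  assumes "\<And>a. a \<in> A \<Longrightarrow> poly_fun (multidegree (e a)) (\<phi> a)"
  shows "poly_fun (multidegree (\<lambda>i. \<Sum>a\<in>A. e a i)) (\<lambda>x. \<Prod>a\<in>A. \<phi> a x)"
  using assms
proof (induction A rule: infinite_finite_induct)
  case (insert a A)
  then show ?case
    by (auto intro!: poly_fun_mult[of "multidegree (e a)" _ "multidegree (\<lambda>i. \<Sum>a\<in>A. e a i)"]
        multidegree_add)
qed (simp_all add: poly_fun_const)

text \<open>The factor \<open>x\<^sub>i\<^sub>j ^ m\<^sub>j\<close> only involves the coordinates of the \<open>i\<close>-th point, so a monomial of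
  degree \<open>d\<close> evaluated there has multidegree \<open>d\<close> in place \<open>i\<close> and 0 elsewhere.\<close>

lemma poly_fun_mon_eval_row:
  "poly_fun (multidegree (\<lambda>i'. if i' = i then mdeg m else 0)) (\<lambda>x. mon_eval (\<lambda>j. x (i, j)) m)"
proof -
  have "poly_fun (multidegree (\<lambda>i'. \<Sum>j\<in>UNIV. if i' = i then Poly_Mapping.lookup m j else 0))
      (\<lambda>x. \<Prod>j\<in>UNIV. mon_eval x (Poly_Mapping.single (i, j) (Poly_Mapping.lookup m j)))"
    by (intro poly_fun_multidegree_prod poly_fun_mon_eval single_in_multidegree)
  moreover have "(\<lambda>i'. \<Sum>j\<in>UNIV. if i' = i then Poly_Mapping.lookup m j else 0) =
      (\<lambda>i'. if i' = i then mdeg m else 0)"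
    by (auto simp: mdeg_def)
  ultimately show ?thesis
    by (simp add: mon_eval_def[of "\<lambda>j. _ (i, j)"])
qed

section \<open>Independence of monomials on points\<close>

definition indep_on :: "('s::finite \<Rightarrow> 'n::finite \<Rightarrow> 'k::field) \<Rightarrow> 'n mon set \<Rightarrow> bool" where
  "indep_on w M \<longleftrightarrow>
     (\<forall>c. (\<forall>i. (\<Sum>m\<in>M. c m * mon_eval (w i) m) = 0) \<longrightarrow> (\<forall>m\<in>M. c m = 0))"

text \<open>Linearly independent functions stay independent on as many suitable points as there are
  functions. One step of Gaussian elimination: choose \<open>x\<close> where some \<open>\<phi>\<^sub>a\<close> does not vanish, subtract
  multiples of \<open>\<phi>\<^sub>a\<close> so that all the others vanish at \<open>x\<close>, and apply induction to those.\<close>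

lemma separating_points_exist:
  fixes \<phi> :: "'m \<Rightarrow> 'x \<Rightarrow> 'k::field"
  assumes "finite M" "finite S" "card S = card M"
    and "\<And>c. (\<And>x. (\<Sum>m\<in>M. c m * \<phi> m x) = 0) \<Longrightarrow> \<forall>m\<in>M. c m = 0"
  shows "\<exists>v. \<forall>c. (\<forall>i\<in>S. (\<Sum>m\<in>M. c m * \<phi> m (v i)) = 0) \<longrightarrow> (\<forall>m\<in>M. c m = 0)"
  using assms
proof (induction M arbitrary: S \<phi> rule: finite_induct)
  case (insert a M)
  note indep = insert.prems(3)
  obtain x where x: "\<phi> a x \<noteq> 0"
  proof (rule ccontr)
    assume "\<not> thesis"
    then have "\<phi> a y = 0" for y
      using that by blast
    moreover have "(\<Sum>m\<in>M. (if m = a then 1 else 0) * \<phi> m y) = 0" for y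
      using insert.hyps by (intro sum.neutral) auto
    ultimately have "\<forall>m\<in>insert a M. (if m = a then 1 else 0) = (0 :: 'k)"
      using insert.hyps by (intro indep) simp
    then show False
      by simp
  qed
  have "card S = Suc (card M)"
    using insert.hyps insert.prems by simp
  then obtain i0 S' where S: "S = insert i0 S'" "i0 \<notin> S'" "card S' = card M"
    by (metis card_Suc_eq)
  define \<psi> where "\<psi> m y = \<phi> m y - \<phi> m x / \<phi> a x * \<phi> a y" for m y
  have split: "(\<Sum>m\<in>insert a M. c m * \<phi> m y) = (\<Sum>m\<in>M. c m * \<psi> m y)"
    if "c a = - (\<Sum>m\<in>M. c m * (\<phi> m x / \<phi> a x))" for c y
    using insert.hyps that
    by (simp add: \<psi>_def right_diff_distrib sum_subtractf sum_distrib_right mult.assoc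
        flip: sum_distrib_left)
  have indep': "\<forall>m\<in>M. c m = 0" if c: "\<And>y. (\<Sum>m\<in>M. c m * \<psi> m y) = 0" for c
  proof -
    \<comment> \<open>With this coefficient at \<open>a\<close>, a relation between the \<open>\<psi>\<close> becomes one between the \<open>\<phi>\<close>.\<close>
    define c' where "c' = c(a := - (\<Sum>m\<in>M. c m * (\<phi> m x / \<phi> a x)))"
    have c': "(\<Sum>m\<in>M. c' m * f m) = (\<Sum>m\<in>M. c m * f m)" for f
      using insert.hyps by (intro sum.cong) (auto simp: c'_def)
    have "c' a = - (\<Sum>m\<in>M. c' m * (\<phi> m x / \<phi> a x))"
      unfolding c' by (simp add: c'_def)
    from split[OF this] have "\<forall>m\<in>insert a M. c' m = 0"
      by (intro indep) (simp add: c' c)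
    then show ?thesis
      using insert.hyps by (auto simp: c'_def split: if_splits)
  qed
  have "finite S'"
    using S insert.prems by simp
  then have "\<exists>v. \<forall>c. (\<forall>i\<in>S'. (\<Sum>m\<in>M. c m * \<psi> m (v i)) = 0) \<longrightarrow> (\<forall>m\<in>M. c m = 0)"
    by (rule insert.IH[OF _ S(3)]) (rule indep')
  then obtain v where v: "\<forall>c. (\<forall>i\<in>S'. (\<Sum>m\<in>M. c m * \<psi> m (v i)) = 0) \<longrightarrow> (\<forall>m\<in>M. c m = 0)"
    by (rule exE)
  show ?case
  proof (intro exI allI impI)
    fix c
    assume c: "\<forall>i\<in>S. (\<Sum>m\<in>insert a M. c m * \<phi> m ((v(i0 := x)) i)) = 0"
    then have "c a * \<phi> a x + (\<Sum>m\<in>M. c m * \<phi> m x) = 0"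
      using S insert.hyps by simp
    then have ca: "c a = - (\<Sum>m\<in>M. c m * (\<phi> m x / \<phi> a x))"
      using x by (simp add: field_simps eq_neg_iff_add_eq_0 flip: sum_divide_distrib)
    have "(\<Sum>m\<in>M. c m * \<psi> m (v i)) = 0" if "i \<in> S'" for i
    proof -
      have "i \<in> S" "i \<noteq> i0"
        using S that by auto
      then have "(\<Sum>m\<in>insert a M. c m * \<phi> m (v i)) = 0"
        using c by auto
      then show ?thesis
        using split[OF ca, of "v i"] by simp
    qed
    then have "\<forall>m\<in>M. c m = 0"
      using v[rule_format, of c] by blast
    with ca show "\<forall>m\<in>insert a M. c m = 0"
      by simp
  qed
qed simp

text \<open>Unit rows and columns outside \<open>S\<close> turn a minor of the evaluation matrix into a determinant
  of fixed size, which leaves room for fewer monomials than points.\<close>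

definition minor_matrix ::
  "'s set \<Rightarrow> ('s \<Rightarrow> 'n::finite mon) \<Rightarrow> ('s \<times> 'n \<Rightarrow> 'k::comm_ring_1) \<Rightarrow> 'k^'s::finite^'s" where
  "minor_matrix S b x = (\<chi> i j. if i \<in> S \<and> j \<in> S then mon_eval (\<lambda>l. x (i, l)) (b j)
     else if i = j then 1 else 0)"

text \<open>The nonzero entries of row \<open>i\<close> depend only on the \<open>i\<close>-th point and share one degree, so all
  terms of the determinant have the same multidegree.\<close>

lemma poly_fun_minor:
  fixes b :: "'s::finite \<Rightarrow> 'n::finite mon"
  assumes "\<And>j. j \<in> S \<Longrightarrow> mdeg (b j) = d"
  shows "poly_fun (multidegree (\<lambda>i'. \<Sum>i\<in>UNIV. if i' = i \<and> i \<in> S then d else 0))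
    (\<lambda>x :: 's \<times> 'n \<Rightarrow> 'k::comm_ring_1. det (minor_matrix S b x))"
proof (intro poly_fun_det poly_fun_multidegree_prod)
  fix p :: "'s \<Rightarrow> 's" and i
  have "poly_fun (multidegree (\<lambda>i'. if i' = i then d else 0))
      (\<lambda>x :: 's \<times> 'n \<Rightarrow> 'k. mon_eval (\<lambda>l. x (i, l)) (b j))"
    if "j \<in> S" for j
    unfolding assms[OF that, symmetric] by (rule poly_fun_mon_eval_row)
  then show "poly_fun (multidegree (\<lambda>i'. if i' = i \<and> i \<in> S then d else 0))
      (\<lambda>x :: 's \<times> 'n \<Rightarrow> 'k. minor_matrix S b x $ i $ p i)"
    by (cases "i \<in> S"; cases "p i \<in> S"; cases "p i = i")
      (auto simp: minor_matrix_def poly_fun_zero poly_fun_const)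
qed

lemma minor_matrix_mult_vec:
  "(minor_matrix S b x *v y) $ i =
     (if i \<in> S then \<Sum>j\<in>S. mon_eval (\<lambda>l. x (i, l)) (b j) * y $ j else y $ i)"
proof -
  have "(minor_matrix S b x *v y) $ i =
    (\<Sum>j\<in>UNIV. if i \<in> S then (if j \<in> S then mon_eval (\<lambda>l. x (i, l)) (b j) * y $ j else 0)
      else if j = i then y $ j else 0)"
    unfolding matrix_vector_mult_def minor_matrix_def by (auto intro!: sum.cong)
  then show ?thesis
    by (simp add: sum.If_cases)
qed

lemma det_nonzero_iff_ker:
  fixes A :: "'k::field^'s^'s"
  shows "det A \<noteq> 0 \<longleftrightarrow> (\<forall>y. A *v y = 0 \<longrightarrow> y = 0)"
  by (simp add: invertible_det_nz[symmetric] invertible_left_inverse matrix_left_invertible_ker)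

lemma minor_nonzero_imp_indep_on:
  assumes b: "bij_betw b S M" and nz: "det (minor_matrix S b x) \<noteq> 0"
  shows "indep_on (\<lambda>i j. x (i, j)) M"
  unfolding indep_on_def
proof (intro allI impI ballI)
  fix c m
  assume c: "\<forall>i. (\<Sum>m\<in>M. c m * mon_eval (\<lambda>j. x (i, j)) m) = 0" and m: "m \<in> M"
  define y where "y = (\<chi> j. if j \<in> S then c (b j) else 0)"
  have y_nth: "y $ j = (if j \<in> S then c (b j) else 0)" for j
    by (simp add: y_def)
  have "(\<Sum>j\<in>S. mon_eval (\<lambda>l. x (i, l)) (b j) * y $ j) =
      (\<Sum>j\<in>S. c (b j) * mon_eval (\<lambda>l. x (i, l)) (b j))" for i
    by (intro sum.cong) (simp_all add: y_nth)
  also have "\<dots> i = (\<Sum>m\<in>M. c m * mon_eval (\<lambda>l. x (i, l)) m)" for i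
    by (rule sum.reindex_bij_betw[OF b])
  finally have "(minor_matrix S b x *v y) $ i = 0" for i
    by (simp add: minor_matrix_mult_vec c) (simp add: y_nth)
  then have "minor_matrix S b x *v y = 0"
    by (simp add: vec_eq_iff)
  then have "y = 0"
    using nz by (simp add: det_nonzero_iff_ker)
  moreover obtain j where "j \<in> S" "m = b j"
    using b m by (auto simp: bij_betw_def)
  ultimately show "c m = 0"
    using y_nth[of j] by simp
qed

lemma minor_nonzero_somewhere:
  fixes b :: "'s::finite \<Rightarrow> 'n::finite mon"
  assumes b: "bij_betw b S M"
  shows "\<exists>x :: 's \<times> 'n \<Rightarrow> 'k::field_char_0. det (minor_matrix S b x) \<noteq> 0"
proof -
  have M: "finite M"
    using bij_betw_finite[OF b] by simp
  have "\<exists>v :: 's \<Rightarrow> 'n \<Rightarrow> 'k.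
      \<forall>c. (\<forall>i\<in>S. (\<Sum>m\<in>M. c m * mon_eval (v i) m) = 0) \<longrightarrow> (\<forall>m\<in>M. c m = 0)"
    by (rule separating_points_exist[OF M])
      (use bij_betw_same_card[OF b] in \<open>auto intro: monomial_functions_independent[OF M]\<close>)
  then obtain v :: "'s \<Rightarrow> 'n \<Rightarrow> 'k" where v:
    "\<forall>c. (\<forall>i\<in>S. (\<Sum>m\<in>M. c m * mon_eval (v i) m) = 0) \<longrightarrow> (\<forall>m\<in>M. c m = 0)"
    by (rule exE)
  have "y = 0" if y: "minor_matrix S b (\<lambda>(i, j). v i j) *v y = 0" for y
  proof -
    define c where "c = (\<lambda>m. y $ the_inv_into S b m)"
    have c: "c (b j) = y $ j" if "j \<in> S" for j
      using b that by (simp add: c_def bij_betw_def the_inv_into_f_f)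
    have row: "(minor_matrix S b (\<lambda>(i, j). v i j) *v y) $ i = 0" for i
      using y by simp
    have "(\<Sum>m\<in>M. c m * mon_eval (v i) m) = 0" if "i \<in> S" for i
      using row[of i] that
      by (simp add: minor_matrix_mult_vec sum.reindex_bij_betw[OF b, symmetric] c mult.commute)
    then have "c m = 0" if "m \<in> M" for m
      using v[rule_format, of c] that by blast
    moreover have "b j \<in> M" if "j \<in> S" for j
      using b that by (auto simp: bij_betw_def)
    ultimately have "y $ j = 0" if "j \<in> S" for j
      using c that by metis
    moreover have "y $ j = 0" if "j \<notin> S" for j
      using row[of j] that by (simp add: minor_matrix_mult_vec)
    ultimately show ?thesis
      by (auto simp: vec_eq_iff)
  qed
  then have "det (minor_matrix S b (\<lambda>(i, j). v i j)) \<noteq> 0"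
    by (simp add: det_nonzero_iff_ker)
  then show ?thesis
    by (rule exI[of _ "\<lambda>(i, j). v i j"])
qed

text \<open>Each of the finitely many sets \<open>M\<close> of at most \<open>s\<close> monomials of one degree \<open>d \<le> D\<close> contributes
  one minor that is not identically zero; \<open>F\<close> is the product of all these minors and of the
  \<open>z\<close>-coordinates of the points. Quantifying over all sets \<open>M\<close> makes the resulting open set
  independent of any term order.\<close>

lemma generic_points_polynomial:
  fixes z :: "'n::finite" and D :: nat
  shows "\<exists>F :: ('k::field_char_0, 's::finite \<times> 'n) mpoly. multihomogeneous F \<and>
    (\<exists>x. meval x F \<noteq> 0) \<and>
    (\<forall>x. meval x F \<noteq> 0 \<longrightarrow> (\<forall>i. x (i, z) \<noteq> 0) \<and>
      (\<forall>d\<le>D. \<forall>M\<subseteq>{m. mdeg m = d}. card M \<le> CARD('s) \<longrightarrow> indep_on (\<lambda>i j. x (i, j)) M))"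
proof -
  define K :: "'n mon set set" where "K = {M. \<exists>d\<le>D. M \<subseteq> {m. mdeg m = d} \<and> card M \<le> CARD('s)}"
  have K: "finite K"
  proof (rule finite_subset)
    show "K \<subseteq> (\<Union>d\<le>D. Pow {m. mdeg m = d})"
      unfolding K_def by blast
  qed (auto simp: finite_mdeg)
  have "\<exists>\<phi> :: ('s \<times> 'n \<Rightarrow> 'k) \<Rightarrow> 'k. (\<exists>e. poly_fun (multidegree e) \<phi>) \<and> (\<exists>x. \<phi> x \<noteq> 0) \<and>
      (\<forall>x. \<phi> x \<noteq> 0 \<longrightarrow> indep_on (\<lambda>i j. x (i, j)) M)" if M: "M \<in> K" for M
  proof -
    obtain d where d: "M \<subseteq> {m. mdeg m = d}" "card M \<le> CARD('s)"
      using M unfolding K_def by blast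
    obtain S :: "'s set" where "card S = card M"
      using d(2) by (metis obtain_subset_with_card_n)
    moreover have "finite M"
      using d(1) finite_mdeg finite_subset by blast
    ultimately obtain b where b: "bij_betw b S M"
      using finite_same_card_bij[of S M] by auto
    have bd: "mdeg (b j) = d" if "j \<in> S" for j
      using b d(1) that by (auto simp: bij_betw_def)
    have "\<exists>e. poly_fun (multidegree e) (\<lambda>x :: 's \<times> 'n \<Rightarrow> 'k. det (minor_matrix S b x))"
      by (rule exI, rule poly_fun_minor[OF bd])
    moreover have "\<exists>x :: 's \<times> 'n \<Rightarrow> 'k. det (minor_matrix S b x) \<noteq> 0"
      by (rule minor_nonzero_somewhere[OF b])
    moreover have "\<forall>x :: 's \<times> 'n \<Rightarrow> 'k. det (minor_matrix S b x) \<noteq> 0 \<longrightarrow>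
        indep_on (\<lambda>i j. x (i, j)) M"
      by (intro allI impI minor_nonzero_imp_indep_on[OF b])
    ultimately show ?thesis
      by (intro exI[of _ "\<lambda>x. det (minor_matrix S b x)"] conjI)
  qed
  then obtain \<phi> :: "'n mon set \<Rightarrow> ('s \<times> 'n \<Rightarrow> 'k) \<Rightarrow> 'k" where
    ex_e: "\<And>M. M \<in> K \<Longrightarrow> \<exists>e. poly_fun (multidegree e) (\<phi> M)" and
    nz: "\<And>M. M \<in> K \<Longrightarrow> \<exists>x. \<phi> M x \<noteq> 0" and
    indep: "\<And>M x. M \<in> K \<Longrightarrow> \<phi> M x \<noteq> 0 \<Longrightarrow> indep_on (\<lambda>i j. x (i, j)) M"
    by metis
  have "\<exists>e. \<forall>M\<in>K. poly_fun (multidegree (e M)) (\<phi> M)"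
    by (rule bchoice) (use ex_e in blast)
  then obtain e where e: "\<And>M. M \<in> K \<Longrightarrow> poly_fun (multidegree (e M)) (\<phi> M)"
    by blast
  let ?H1 = "\<lambda>x :: 's \<times> 'n \<Rightarrow> 'k. \<Prod>M\<in>K. \<phi> M x"
  let ?H2 = "\<lambda>x :: 's \<times> 'n \<Rightarrow> 'k. \<Prod>i\<in>UNIV. x (i, z)"
  define e1 where "e1 = (\<lambda>i. \<Sum>M\<in>K. e M i)"
  define e2 where "e2 = (\<lambda>i. \<Sum>i'\<in>(UNIV :: 's set). if i = i' then 1 else 0 :: nat)"
  have H1: "poly_fun (multidegree e1) ?H1"
    unfolding e1_def by (rule poly_fun_multidegree_prod[OF e])
  have H2: "poly_fun (multidegree e2) ?H2"
    unfolding e2_def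
  proof (rule poly_fun_multidegree_prod)
    fix i :: 's
    show "poly_fun (multidegree (\<lambda>i'. if i' = i then 1 else 0)) (\<lambda>x :: 's \<times> 'n \<Rightarrow> 'k. x (i, z))"
      using poly_fun_mon_eval[OF single_in_multidegree[of i z 1]] by simp
  qed
  have "\<exists>x. ?H1 x \<noteq> 0"
    by (intro poly_fun_prod_nonzero_somewhere[OF K] nz) (auto intro: poly_fun_mono[OF e])
  then obtain x0 where "?H1 x0 \<noteq> 0"
    by (rule exE)
  then have "\<exists>x. ?H1 x \<noteq> 0 \<and> ?H2 x \<noteq> 0"
    by (rule poly_fun_common_nonzero[OF H1 H2, of x0 "\<lambda>_. 1"]) simp
  then obtain x1 where x1: "?H1 x1 \<noteq> 0 \<and> ?H2 x1 \<noteq> 0"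
    by (rule exE)
  have "poly_fun (multidegree (\<lambda>i. e1 i + e2 i)) (\<lambda>x. ?H1 x * ?H2 x)"
    by (rule poly_fun_mult[OF H1 H2]) (rule multidegree_add)
  then have "\<exists>F. Poly_Mapping.keys F \<subseteq> multidegree (\<lambda>i. e1 i + e2 i) \<and>
      (\<forall>x. ?H1 x * ?H2 x = meval x F)"
    unfolding poly_fun_def .
  then obtain F where F: "Poly_Mapping.keys F \<subseteq> multidegree (\<lambda>i. e1 i + e2 i) \<and>
      (\<forall>x. ?H1 x * ?H2 x = meval x F)"
    by (rule exE)
  then have F_eq: "meval x F = ?H1 x * ?H2 x" for x
    by simp
  show ?thesis
  proof (intro exI conjI allI impI)
    show "multihomogeneous F"
      unfolding multihomogeneous_def
      by (rule exI[of _ "\<lambda>i. e1 i + e2 i"]) (use F in \<open>auto simp: multidegree_def\<close>)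
    show "meval x1 F \<noteq> 0"
      using x1 F_eq by simp
    fix x assume nz: "meval x F \<noteq> 0"
    then show "x (i, z) \<noteq> 0" for i
      using F_eq[of x] by auto
    fix d :: nat and M :: "'n mon set"
    assume "d \<le> D" "M \<subseteq> {m. mdeg m = d}" "card M \<le> CARD('s)"
    then have "M \<in> K"
      unfolding K_def by blast
    moreover from this have "\<phi> M x \<noteq> 0"
      using F_eq[of x] nz prod_zero[OF K, of "\<lambda>M. \<phi> M x"] by auto
    ultimately show "indep_on (\<lambda>i j. x (i, j)) M"
      by (rule indep)
  qed
qed

section \<open>Low and high monomials of a term order\<close>

text \<open>The \<open>s\<close> smallest monomials of degree \<open>d\<close>, or all of them if there are fewer.\<close>

definition low_mons :: "'n::finite mon rel \<Rightarrow> nat \<Rightarrow> nat \<Rightarrow> 'n mon set" where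
  "low_mons \<tau> s d = {m. mdeg m = d \<and> card {m'. mdeg m' = d \<and> mon_less \<tau> m' m} < s}"

definition high_mons :: "'n::finite mon rel \<Rightarrow> nat \<Rightarrow> nat \<Rightarrow> 'n mon set" where
  "high_mons \<tau> s d = {m. mdeg m = d} - low_mons \<tau> s d"

lemma finite_mdeg_subset [simp]: "finite {m :: 'n::finite mon. mdeg m = d \<and> P m}"
  by (rule finite_subset[OF _ finite_mdeg[of d]]) blast

lemma finite_low_mons [simp]: "finite (low_mons \<tau> s d)"
  by (simp add: low_mons_def)

lemma finite_high_mons [simp]: "finite (high_mons \<tau> s d)"
  by (simp add: high_mons_def finite_mdeg)

lemma mdeg_low_mons: "m \<in> low_mons \<tau> s d \<Longrightarrow> mdeg m = d"
  by (simp add: low_mons_def)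

lemma mdeg_high_mons: "m \<in> high_mons \<tau> s d \<Longrightarrow> mdeg m = d"
  by (simp add: high_mons_def)

lemma low_high_disjoint: "m \<in> low_mons \<tau> s d \<Longrightarrow> m \<notin> high_mons \<tau> s d'"
  by (auto simp: low_mons_def high_mons_def)

context
  fixes \<tau> :: "'n::finite mon rel"
  assumes \<tau>: "term_order \<tau>"
begin

lemma mon_less_irrefl [simp]: "\<not> mon_less \<tau> a a"
  by (simp add: mon_less_def)

lemma term_order_antisym: "(a, b) \<in> \<tau> \<Longrightarrow> (b, a) \<in> \<tau> \<Longrightarrow> a = b"
  using \<tau> unfolding term_order_def order_on_defs antisym_def by blast

lemma term_order_trans: "(a, b) \<in> \<tau> \<Longrightarrow> (b, c) \<in> \<tau> \<Longrightarrow> (a, c) \<in> \<tau>"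
  using \<tau> unfolding term_order_def order_on_defs trans_def by blast

lemma term_order_total: "(a, b) \<in> \<tau> \<or> (b, a) \<in> \<tau>"
  using \<tau> unfolding term_order_def order_on_defs total_on_def
  by (cases "a = b") (auto dest: refl_onD)

lemma mon_less_trans: "mon_less \<tau> a b \<Longrightarrow> mon_less \<tau> b c \<Longrightarrow> mon_less \<tau> a c"
  unfolding mon_less_def using term_order_trans term_order_antisym by blast

lemma mon_less_linear: "mon_less \<tau> a b \<or> a = b \<or> mon_less \<tau> b a"
  unfolding mon_less_def using term_order_total by blast

lemma mon_less_add: "mon_less \<tau> a b \<Longrightarrow> mon_less \<tau> (c + a) (c + b)"
  using \<tau> unfolding mon_less_def term_order_def by (metis add.commute add_left_imp_eq)

lemma ex_greatest_mon:
  assumes "finite A" "A \<noteq> {}"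
  shows "\<exists>m\<in>A. \<forall>a\<in>A. (a, m) \<in> \<tau>"
  using assms
proof (induction A rule: finite_ne_induct)
  case (singleton x)
  then show ?case
    using term_order_total by blast
next
  case (insert x A)
  then obtain m where m: "m \<in> A" "\<forall>a\<in>A. (a, m) \<in> \<tau>"
    by blast
  show ?case
  proof (cases "(x, m) \<in> \<tau>")
    case True
    then show ?thesis
      using m by blast
  next
    case False
    then have "(m, x) \<in> \<tau>" "(x, x) \<in> \<tau>"
      using term_order_total by blast+
    then show ?thesis
      using m term_order_trans by blast
  qed
qed

lemma ex_least_mon:
  assumes "finite A" "A \<noteq> {}"
  shows "\<exists>m\<in>A. \<forall>a\<in>A. (m, a) \<in> \<tau>"
  using assms
proof (induction A rule: finite_ne_induct)
  case (singleton x)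
  then show ?case
    using term_order_total by blast
next
  case (insert x A)
  then obtain m where m: "m \<in> A" "\<forall>a\<in>A. (m, a) \<in> \<tau>"
    by blast
  show ?case
  proof (cases "(m, x) \<in> \<tau>")
    case True
    then show ?thesis
      using m by blast
  next
    case False
    then have "(x, m) \<in> \<tau>" "(x, x) \<in> \<tau>"
      using term_order_total by blast+
    then show ?thesis
      using m term_order_trans by blast
  qed
qed

lemma lead_mon_eqI:
  assumes "m \<in> Poly_Mapping.keys f" "\<And>m'. m' \<in> Poly_Mapping.keys f \<Longrightarrow> (m', m) \<in> \<tau>"
  shows "lead_mon \<tau> f = m"
  unfolding lead_mon_def
  by (rule the_equality) (use assms term_order_antisym in blast)+

lemma lead_mon_greatest:
  assumes "f \<noteq> 0"
  shows "lead_mon \<tau> f \<in> Poly_Mapping.keys f"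
    and "m \<in> Poly_Mapping.keys f \<Longrightarrow> (m, lead_mon \<tau> f) \<in> \<tau>"
proof -
  have "Poly_Mapping.keys f \<noteq> {}"
    using assms by (metis keys_eq_empty)
  then obtain k where k: "k \<in> Poly_Mapping.keys f" "\<forall>a\<in>Poly_Mapping.keys f. (a, k) \<in> \<tau>"
    using ex_greatest_mon[OF finite_keys] by blast
  then have "lead_mon \<tau> f = k"
    by (intro lead_mon_eqI) auto
  with k show "lead_mon \<tau> f \<in> Poly_Mapping.keys f"
    and "m \<in> Poly_Mapping.keys f \<Longrightarrow> (m, lead_mon \<tau> f) \<in> \<tau>"
    by blast+
qed

lemma low_mons_downward:
  assumes "m \<in> low_mons \<tau> s d" "mdeg m' = d" "mon_less \<tau> m' m"
  shows "m' \<in> low_mons \<tau> s d"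
proof -
  have "card {a. mdeg a = d \<and> mon_less \<tau> a m'} \<le> card {a. mdeg a = d \<and> mon_less \<tau> a m}"
    by (rule card_mono) (use assms(3) mon_less_trans in auto)
  then show ?thesis
    using assms by (simp add: low_mons_def)
qed

lemma low_less_high:
  assumes "a \<in> low_mons \<tau> s d" "m \<in> high_mons \<tau> s d"
  shows "mon_less \<tau> a m"
proof -
  have "a \<noteq> m"
    using assms low_high_disjoint by blast
  moreover have "\<not> mon_less \<tau> m a"
    using assms low_mons_downward low_high_disjoint mdeg_high_mons by blast
  ultimately show ?thesis
    using mon_less_linear by blast
qed

lemma high_mons_upward:
  assumes "m \<in> high_mons \<tau> s d" "mdeg m' = d" "mon_less \<tau> m m'"
  shows "m' \<in> high_mons \<tau> s d"
  using assms low_mons_downward[of m' s d m] mdeg_high_mons[of m \<tau> s d]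
  unfolding high_mons_def by blast

lemma card_low_mons_le: "card (low_mons \<tau> s d) \<le> s"
proof (cases "low_mons \<tau> s d = {}")
  case False
  then obtain m where m: "m \<in> low_mons \<tau> s d" "\<forall>a\<in>low_mons \<tau> s d. (a, m) \<in> \<tau>"
    using ex_greatest_mon[OF finite_low_mons] by blast
  have "low_mons \<tau> s d \<subseteq> insert m {a. mdeg a = d \<and> mon_less \<tau> a m}"
    using m by (auto simp: mon_less_def dest: mdeg_low_mons)
  then have "card (low_mons \<tau> s d) \<le> card (insert m {a. mdeg a = d \<and> mon_less \<tau> a m})"
    by (intro card_mono) auto
  then show ?thesis
    using m(1) by (simp add: low_mons_def)
qed simp

text \<open>Below the least high monomial all monomials of its degree are low, and there are at least
  \<open>s\<close> of them.\<close>

lemma card_low_mons_eq: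
  assumes "high_mons \<tau> s d \<noteq> {}"
  shows "card (low_mons \<tau> s d) = s"
proof -
  obtain m where m: "m \<in> high_mons \<tau> s d" "\<forall>a\<in>high_mons \<tau> s d. (m, a) \<in> \<tau>"
    using ex_least_mon[OF finite_high_mons assms] by blast
  have "{a. mdeg a = d \<and> mon_less \<tau> a m} \<subseteq> low_mons \<tau> s d"
    using m term_order_antisym by (auto simp: high_mons_def mon_less_def)
  then have "card {a. mdeg a = d \<and> mon_less \<tau> a m} \<le> card (low_mons \<tau> s d)"
    by (intro card_mono) auto
  moreover have "s \<le> card {a. mdeg a = d \<and> mon_less \<tau> a m}"
    using m(1) by (auto simp: high_mons_def low_mons_def)
  ultimately show ?thesis
    using card_low_mons_le[of s d] by simp
qed

text \<open>The high monomials form an upper set, so they are the largest ones in the sense of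
  \<^const>\<open>Seg\<close>, whatever their number.\<close>

lemma high_mons_eq_top:
  "high_mons \<tau> s d =
     {m. mdeg m = d \<and> card {m'. mdeg m' = d \<and> mon_less \<tau> m m'} < card (high_mons \<tau> s d)}"
proof (intro equalityI subsetI)
  fix m assume m: "m \<in> high_mons \<tau> s d"
  then have "{m'. mdeg m' = d \<and> mon_less \<tau> m m'} \<subset> high_mons \<tau> s d"
    using high_mons_upward[OF m] mon_less_irrefl[of m] by blast
  then show "m \<in> {m. mdeg m = d \<and>
      card {m'. mdeg m' = d \<and> mon_less \<tau> m m'} < card (high_mons \<tau> s d)}"
    using m mdeg_high_mons by (auto intro: psubset_card_mono)
next
  fix m assume m: "m \<in> {m. mdeg m = d \<and>
      card {m'. mdeg m' = d \<and> mon_less \<tau> m m'} < card (high_mons \<tau> s d)}"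
  show "m \<in> high_mons \<tau> s d"
  proof (rule ccontr)
    assume "m \<notin> high_mons \<tau> s d"
    then have "m \<in> low_mons \<tau> s d"
      using m by (simp add: high_mons_def)
    then have "high_mons \<tau> s d \<subseteq> {m'. mdeg m' = d \<and> mon_less \<tau> m m'}"
      using low_less_high mdeg_high_mons by blast
    then have "card (high_mons \<tau> s d) \<le> card {m'. mdeg m' = d \<and> mon_less \<tau> m m'}"
      by (intro card_mono) auto
    then show False
      using m by simp
  qed
qed

text \<open>Multiplication by \<open>a\<close> embeds the monomials below \<open>m\<close> into those below \<open>a + m\<close>. This is why
  the segments of the theorem form an ideal.\<close>

lemma high_mons_add:
  assumes "m \<in> high_mons \<tau> s d"
  shows "a + m \<in> high_mons \<tau> s (mdeg a + d)"
proof -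
  let ?L = "\<lambda>m. {m'. mdeg m' = mdeg m \<and> mon_less \<tau> m' m}"
  have "card (?L m) = card ((+) a ` ?L m)"
    by (simp add: card_image inj_on_def)
  also have "\<dots> \<le> card (?L (a + m))"
    by (rule card_mono) (auto simp: mdeg_add intro: mon_less_add)
  finally show ?thesis
    using assms by (auto simp: high_mons_def low_mons_def mdeg_add)
qed

end

text \<open>Replacing the variables of \<open>m\<close>, none of which is the smallest one, by the smallest variable
  one after the other gives a strictly decreasing chain of \<open>mdeg m\<close> monomials below \<open>m\<close>.\<close>

lemma card_below_ge_mdeg:
  fixes \<tau> :: "'n::{finite,linorder} mon rel"
  assumes \<tau>: "term_order \<tau>" "vars_decreasing \<tau>"
    and z: "\<And>i. i \<le> z" and m: "Poly_Mapping.lookup m z = 0"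
  shows "mdeg m \<le> card {m'. mdeg m' = mdeg m \<and> mon_less \<tau> m' m}"
  using m
proof (induction "mdeg m" arbitrary: m)
  case (Suc d)
  obtain i where i: "Poly_Mapping.lookup m i \<noteq> 0"
  proof (rule ccontr)
    assume "\<not> thesis"
    then have "mdeg m = 0"
      using that by (simp add: mdeg_def) blast
    then show False
      using Suc.hyps(2) by simp
  qed
  define m1 where "m1 = m - Poly_Mapping.single i 1"
  have m_eq: "m = Poly_Mapping.single i 1 + m1"
    unfolding m1_def using i
    by (intro poly_mapping_eqI) (auto simp: lookup_add lookup_minus lookup_single when_def)
  have d: "mdeg m1 = d"
    using Suc.hyps(2) m_eq mdeg_add[of "Poly_Mapping.single i 1" m1] by simp
  have "Poly_Mapping.lookup m1 z = 0"
    using Suc.prems by (simp add: m1_def lookup_minus)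
  with Suc.hyps(1) d have IH: "d \<le> card {m'. mdeg m' = mdeg m1 \<and> mon_less \<tau> m' m1}"
    by blast
  let ?x = "Poly_Mapping.single z 1 :: 'n mon"
  have "i < z"
    using z[of i] i Suc.prems by (metis order_le_imp_less_or_eq)
  then have "mon_less \<tau> ?x (Poly_Mapping.single i 1)"
    using \<tau>(2) by (simp add: vars_decreasing_def)
  then have *: "mon_less \<tau> (?x + m1) m"
    unfolding m_eq using mon_less_add[OF \<tau>(1), of ?x "Poly_Mapping.single i 1" m1]
    by (simp add: add.commute)
  have "(+) ?x ` insert m1 {m'. mdeg m' = mdeg m1 \<and> mon_less \<tau> m' m1}
      \<subseteq> {m'. mdeg m' = mdeg m \<and> mon_less \<tau> m' m}"
    using * mon_less_trans[OF \<tau>(1) mon_less_add[OF \<tau>(1)] *] d Suc.hyps(2)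
    by (auto simp: mdeg_add)
  then have "card ((+) ?x ` insert m1 {m'. mdeg m' = mdeg m1 \<and> mon_less \<tau> m' m1})
      \<le> card {m'. mdeg m' = mdeg m \<and> mon_less \<tau> m' m}"
    by (intro card_mono) auto
  moreover have "card ((+) ?x ` insert m1 {m'. mdeg m' = mdeg m1 \<and> mon_less \<tau> m' m1})
      = Suc (card {m'. mdeg m' = mdeg m1 \<and> mon_less \<tau> m' m1})"
    by (subst card_image) (auto simp: inj_on_def mon_less_irrefl[OF \<tau>(1)])
  ultimately show ?case
    using IH Suc.hyps(2) by simp
qed simp

text \<open>In degree at least \<open>s\<close> a monomial prime to the last variable has too many smaller ones to be
  low. Hence the low monomials of all higher degrees are multiples of low monomials of degree \<open>s\<close>
  by powers of the last variable.\<close>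

lemma low_mons_divisible_by_last:
  fixes \<tau> :: "'n::{finite,linorder} mon rel"
  assumes \<tau>: "term_order \<tau>" "vars_decreasing \<tau>" and z: "\<And>i. i \<le> z"
    and d: "s \<le> Suc d" and m: "m \<in> low_mons \<tau> s (Suc d)"
  shows "\<exists>m'\<in>low_mons \<tau> s d. m = Poly_Mapping.single z 1 + m'"
proof -
  let ?L = "\<lambda>m. {m'. mdeg m' = mdeg m \<and> mon_less \<tau> m' m}"
  let ?x = "Poly_Mapping.single z 1 :: 'n mon"
  have "Poly_Mapping.lookup m z \<noteq> 0"
    using card_below_ge_mdeg[OF \<tau>, of z m] m z d by (auto simp: low_mons_def)
  define m1 where "m1 = m - ?x"
  have m_eq: "m = ?x + m1"
    unfolding m1_def using \<open>Poly_Mapping.lookup m z \<noteq> 0\<close>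
    by (intro poly_mapping_eqI) (auto simp: lookup_add lookup_minus lookup_single when_def)
  then have "mdeg m1 = d"
    using m mdeg_add[of ?x m1] by (simp add: low_mons_def)
  moreover have "card (?L m1) < s"
  proof -
    have "card (?L m1) = card ((+) ?x ` ?L m1)"
      by (simp add: card_image inj_on_def)
    also have "\<dots> \<le> card (?L m)"
      unfolding m_eq by (rule card_mono) (auto simp: mdeg_add intro: mon_less_add[OF \<tau>(1)])
    finally show ?thesis
      using m by (auto simp: low_mons_def)
  qed
  ultimately show ?thesis
    using m_eq by (auto simp: low_mons_def)
qed

section \<open>Forms vanishing on points\<close>

definition hom_part :: "nat \<Rightarrow> ('k::comm_ring_1, 'n::finite) mpoly \<Rightarrow> ('k, 'n) mpoly" where
  "hom_part d f = (\<Sum>m\<in>{m\<in>Poly_Mapping.keys f. mdeg m = d}. Poly_Mapping.single m (Poly_Mapping.lookup f m))"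

lemma lookup_hom_part:
  "Poly_Mapping.lookup (hom_part d f) m = (if mdeg m = d then Poly_Mapping.lookup f m else 0)"
proof -
  have "Poly_Mapping.lookup (hom_part d f) m =
      (\<Sum>m'\<in>{m\<in>Poly_Mapping.keys f. mdeg m = d}. if m' = m then Poly_Mapping.lookup f m' else 0)"
    unfolding hom_part_def lookup_sum by (intro sum.cong) (auto simp: lookup_single when_def)
  then show ?thesis
    by (simp add: in_keys_iff)
qed

lemma keys_hom_part: "Poly_Mapping.keys (hom_part d f) = {m \<in> Poly_Mapping.keys f. mdeg m = d}"
  by (auto simp: in_keys_iff lookup_hom_part split: if_splits)

lemma hom_part_in_forms: "hom_part d f \<in> forms d"
  by (simp add: forms_def keys_hom_part)

lemma hom_part_forms: "f \<in> forms e \<Longrightarrow> hom_part d f = (if d = e then f else 0)"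
  by (intro poly_mapping_eqI) (auto simp: lookup_hom_part forms_def in_keys_iff)

lemma sum_hom_parts: "f = (\<Sum>d\<in>mdeg ` Poly_Mapping.keys f. hom_part d f)"
proof (rule poly_mapping_eqI)
  fix m
  have "(\<Sum>d\<in>mdeg ` Poly_Mapping.keys f. Poly_Mapping.lookup (hom_part d f) m)
      = (\<Sum>d\<in>mdeg ` Poly_Mapping.keys f. if d = mdeg m then Poly_Mapping.lookup f m else 0)"
    by (intro sum.cong) (auto simp: lookup_hom_part)
  then show "Poly_Mapping.lookup f m =
      Poly_Mapping.lookup (\<Sum>d\<in>mdeg ` Poly_Mapping.keys f. hom_part d f) m"
    by (auto simp: lookup_sum in_keys_iff)
qed

lemma meval_scale_forms:
  assumes "f \<in> forms d"
  shows "meval (\<lambda>j. t * x j) f = t ^ d * meval x f"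
  using assms unfolding meval_eq_sum_superset[OF finite_keys order_refl]
  by (simp add: forms_def mon_eval_scale sum_distrib_left ac_simps)

text \<open>Vanishing on the whole lines through the \<open>w i\<close>, and not only at these vectors, makes an
  inhomogeneous polynomial over an infinite field vanish exactly when all its homogeneous parts do.\<close>

definition vanishing_ideal :: "('s \<Rightarrow> 'n::finite \<Rightarrow> 'k::comm_ring_1) \<Rightarrow> ('k, 'n) mpoly set" where
  "vanishing_ideal w = {f. \<forall>i t. meval (\<lambda>j. t * w i j) f = 0}"

lemma is_ideal_vanishing_ideal: "is_ideal (vanishing_ideal w)"
  by (rule mp_ideal.subspaceI) (simp_all add: vanishing_ideal_def meval_add meval_mult)

text \<open>On the line through \<open>w i\<close>, \<open>f\<close> is a polynomial in \<open>t\<close> whose coefficients are the values of the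
  homogeneous parts of \<open>f\<close> at \<open>w i\<close>; over an infinite field it is zero only if they all are.\<close>

lemma vanishing_ideal_iff:
  fixes w :: "'s \<Rightarrow> 'n::finite \<Rightarrow> 'k::field_char_0"
  shows "f \<in> vanishing_ideal w \<longleftrightarrow> (\<forall>i d. meval (w i) (hom_part d f) = 0)"
proof -
  let ?D = "mdeg ` Poly_Mapping.keys f"
  have eval: "meval (\<lambda>j. t * w i j) f = (\<Sum>d\<in>?D. t ^ d * meval (w i) (hom_part d f))" for i t
    by (subst sum_hom_parts[of f]) (simp add: meval_sum meval_scale_forms[OF hom_part_in_forms])
  have "meval (w i) (hom_part d f) = 0" if f: "f \<in> vanishing_ideal w" for i d
  proof -
    define p where "p = (\<Sum>d\<in>?D. monom (meval (w i) (hom_part d f)) d)"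
    have "poly p t = 0" for t
      using f eval[of t i]
      by (simp add: p_def poly_sum poly_monom vanishing_ideal_def mult.commute)
    then have "p = 0"
      using poly_all_0_iff_0 by blast
    moreover have "coeff p d = (if d \<in> ?D then meval (w i) (hom_part d f) else 0)"
      by (simp add: p_def coeff_sum)
    moreover have "hom_part d f = 0" if "d \<notin> ?D"
    proof -
      have "Poly_Mapping.keys (hom_part d f) = {}"
        using that by (auto simp: keys_hom_part)
      then show ?thesis
        by simp
    qed
    ultimately show ?thesis
      by (metis coeff_0 meval_zero)
  qed
  then show ?thesis
    using eval by (auto simp: vanishing_ideal_def)
qed

lemma hom_part_in_vanishing_ideal:
  fixes w :: "'s \<Rightarrow> 'n::finite \<Rightarrow> 'k::field_char_0"
  assumes "f \<in> vanishing_ideal w"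
  shows "hom_part d f \<in> vanishing_ideal w"
  using assms by (auto simp: vanishing_ideal_iff hom_part_forms[OF hom_part_in_forms])

lemma hom_coords_multiple:
  assumes "v \<in> hom_coords p" "u \<in> hom_coords p"
  shows "\<exists>c. u = c *s v"
proof -
  obtain x where x: "Rep_proj p = vec.span {x}"
    using Rep_proj[of p] by blast
  have "v \<in> vec.span {x}" "u \<in> vec.span {x}" "v \<noteq> 0"
    using assms by (auto simp: hom_coords_def x)
  then obtain a b where ab: "v = a *s x" "u = b *s x"
    by (auto simp: vec.span_singleton)
  then have "u = (b / a) *s v"
    using \<open>v \<noteq> 0\<close> by (auto simp: vec_eq_iff)
  then show ?thesis ..
qed

lemma points_ideal_eq:
  fixes P :: "'s::finite \<Rightarrow> ('k::field_char_0, 'n::finite) proj"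
  assumes v: "\<And>i. v i \<in> hom_coords (P i)"
  shows "points_ideal P = vanishing_ideal (\<lambda>i. ($) (v i))"
proof
  let ?G = "{f. (\<exists>d. f \<in> forms d) \<and> (\<forall>i. \<forall>v\<in>hom_coords (P i). meval (($) v) f = 0)}"
  have "f \<in> vanishing_ideal (\<lambda>i. ($) (v i))" if G: "f \<in> ?G" for f
  proof -
    have f: "meval (($) (v i)) f = 0" for i
      using G v by blast
    obtain d where "f \<in> forms d"
      using G by blast
    then show ?thesis
      using f by (simp add: vanishing_ideal_def meval_scale_forms)
  qed
  then show "points_ideal P \<subseteq> vanishing_ideal (\<lambda>i. ($) (v i))"
    unfolding points_ideal_def
    by (intro mp_ideal.span_minimal is_ideal_vanishing_ideal) blast
  show "vanishing_ideal (\<lambda>i. ($) (v i)) \<subseteq> points_ideal P"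
  proof
    fix f assume f: "f \<in> vanishing_ideal (\<lambda>i. ($) (v i))"
    have "hom_part d f \<in> ?G" for d
    proof -
      have "meval (($) u) (hom_part d f) = 0" if u: "u \<in> hom_coords (P i)" for i u
      proof -
        obtain c where "u = c *s v i"
          using hom_coords_multiple[OF v u] by blast
        then have "($) u = (\<lambda>j. c * v i $ j)"
          by auto
        then show ?thesis
          using f by (simp add: meval_scale_forms[OF hom_part_in_forms] vanishing_ideal_iff)
      qed
      then show ?thesis
        using hom_part_in_forms by blast
    qed
    then have "(\<Sum>d\<in>mdeg ` Poly_Mapping.keys f. hom_part d f) \<in> points_ideal P"
      unfolding points_ideal_def by (intro mp_ideal.span_sum mp_ideal.span_base)
    then show "f \<in> points_ideal P"
      using sum_hom_parts[of f] by simp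
  qed
qed

section \<open>Change of coordinates\<close>

text \<open>The row vector \<open>(det g) v g\<^sup>-\<^sup>1\<close>, written by Cramer's rule: it spans the same line as
  \<open>v g\<^sup>-\<^sup>1\<close>, but is polynomial in the entries of \<open>g\<close>.\<close>

definition moved_point :: "'k::comm_ring_1^'n^'n \<Rightarrow> 'k^'n \<Rightarrow> 'n::finite \<Rightarrow> 'k" where
  "moved_point g v k = det (\<chi> a b. if b = k then v $ a else g $ b $ a)"

lemma moved_point_mult:
  fixes g :: "'k::field^'n::finite^'n"
  assumes g: "invertible g"
  shows "(\<Sum>i\<in>UNIV. moved_point g v i * g $ i $ j) = det g * v $ j"
proof -
  have d: "det (transpose g) \<noteq> 0"
    using g by (simp add: det_transpose invertible_det_nz)
  have mp: "moved_point g v k = det (\<chi> i j. if j = k then v $ i else transpose g $ i $ j)" for k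
    by (simp add: moved_point_def Finite_Cartesian_Product.transpose_def cong: if_cong)
  have "transpose g *v (\<chi> k. moved_point g v k / det (transpose g)) = v"
    unfolding mp by (rule iffD2[OF cramer[OF d]]) (rule refl)
  then have "(transpose g *v (\<chi> k. moved_point g v k / det (transpose g))) $ j = v $ j"
    by simp
  then have "(\<Sum>i\<in>UNIV. moved_point g v i * g $ i $ j) / det g = v $ j"
    by (simp add: matrix_vector_mult_def Finite_Cartesian_Product.transpose_def[of g]
        det_transpose[unfolded Finite_Cartesian_Product.transpose_def]
        sum_divide_distrib mult.commute)
  then show ?thesis
    using g by (simp add: invertible_det_nz field_simps)
qed

lemma moved_point_mat_1: "moved_point (mat 1) v = (($) (v :: 'k::field^'n::finite))"
proof
  fix j
  have "invertible (mat 1 :: 'k^'n^'n)"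
    by (simp add: invertible_def)
  from moved_point_mult[OF this, of v j]
  have "(\<Sum>i\<in>UNIV. moved_point (mat 1) v i * mat 1 $ i $ j) = v $ j"
    by simp
  moreover have "(\<Sum>i\<in>UNIV. x i * mat 1 $ i $ j) = x j" for x :: "'n \<Rightarrow> 'k"
    by (simp add: mat_def if_distrib[of "(*) _"] cong: if_cong)
  ultimately show "moved_point (mat 1) v j = v $ j"
    by simp
qed

lemma poly_fun_moved_point:
  "poly_fun UNIV (\<lambda>x. moved_point (\<chi> i j. x (i, j)) v k)"
  unfolding moved_point_def
proof (intro poly_fun_UNIV_det)
  fix a b
  show "poly_fun UNIV (\<lambda>x. (\<chi> a b. if b = k then v $ a else (\<chi> i j. x (i, j)) $ b $ a) $ a $ b)"
    by (cases "b = k") (simp_all add: poly_fun_const poly_fun_coord)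
qed

lemma gl_act_vanishing_ideal:
  fixes g :: "'k::field_char_0^'n::finite^'n" and v :: "'s \<Rightarrow> 'k^'n"
  assumes g: "invertible g"
  shows "gl_act g ` vanishing_ideal (\<lambda>i. ($) (v i)) = vanishing_ideal (\<lambda>i. moved_point g (v i))"
    (is "?L = ?R")
proof
  have move: "(\<lambda>j. \<Sum>k\<in>UNIV. (t * moved_point g (v i) k) * g $ k $ j) = (\<lambda>j. (t * det g) * v i $ j)"
    for t i
    using moved_point_mult[OF g, of "v i"]
    by (simp add: mult.assoc flip: sum_distrib_left)
  have nz: "det g \<noteq> 0"
    using g by (simp add: invertible_det_nz)
  show "?L \<subseteq> ?R"
    by (auto simp: vanishing_ideal_def meval_gl_act move)
  obtain h where h: "g ** h = mat 1" "h ** g = mat 1"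
    using g unfolding invertible_def by blast
  have inv: "(\<Sum>k\<in>UNIV. (\<Sum>i\<in>UNIV. x i * a $ i $ k) * b $ k $ j) = x j"
    if "a ** b = mat 1" for a b :: "'k^'n^'n" and x :: "'n \<Rightarrow> 'k" and j
  proof -
    have "(\<Sum>k\<in>UNIV. (\<Sum>i\<in>UNIV. x i * a $ i $ k) * b $ k $ j)
        = (\<Sum>k\<in>UNIV. \<Sum>i\<in>UNIV. x i * (a $ i $ k * b $ k $ j))"
      by (simp add: sum_distrib_right mult.assoc)
    also have "\<dots> = (\<Sum>i\<in>UNIV. x i * (\<Sum>k\<in>UNIV. a $ i $ k * b $ k $ j))"
      by (subst sum.swap) (simp add: sum_distrib_left)
    also have "\<dots> = (\<Sum>i\<in>UNIV. x i * (a ** b) $ i $ j)"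
      by (simp add: matrix_matrix_mult_def)
    also have "\<dots> = x j"
      by (simp add: that mat_def if_distrib[of "(*) _"] cong: if_cong)
    finally show ?thesis .
  qed
  show "?R \<subseteq> ?L"
  proof
    fix f assume f: "f \<in> ?R"
    have "gl_act h f \<in> vanishing_ideal (\<lambda>i. ($) (v i))"
      unfolding vanishing_ideal_def mem_Collect_eq
    proof (intro allI)
      fix i t
      have "t * v i $ j = (\<Sum>k\<in>UNIV. (t / det g * moved_point g (v i) k) * g $ k $ j)" for j
        using fun_cong[OF move[of "t / det g" i], of j] nz by simp
      then have "meval (\<lambda>j. t * v i $ j) (gl_act h f) =
          meval (\<lambda>j. t / det g * moved_point g (v i) j) f"
        unfolding meval_gl_act by (simp only: inv[OF h(1)])
      then show "meval (\<lambda>j. t * v i $ j) (gl_act h f) = 0"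
        using f unfolding vanishing_ideal_def mem_Collect_eq by metis
    qed
    moreover have "f - gl_act g (gl_act h f) = 0"
    proof (rule meval_eq_zero_imp_zero)
      fix x
      show "meval x (f - gl_act g (gl_act h f)) = 0"
        by (simp add: meval_diff meval_gl_act inv[OF h(1)] inv[OF h(2)])
    qed
    ultimately show "f \<in> ?L"
      by (metis eq_iff_diff_eq_0 imageI)
  qed
qed

section \<open>Spans of monomials\<close>

lemma lookup_const_mult: "Poly_Mapping.lookup (const c * f) m = c * Poly_Mapping.lookup f m"
  unfolding const_def mult_map_scale_conv_mult[symmetric] by (simp add: Poly_Mapping.map.rep_eq when_def)

lemma mpoly_eq_sum_mon_poly:
  "f = (\<Sum>m\<in>Poly_Mapping.keys f. const (Poly_Mapping.lookup f m) * mon_poly m)"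
  using mpoly_eq_sum_single[of f] by (simp add: const_def mon_poly_def mult_single)

lemma keys_subset_iff: "Poly_Mapping.keys f \<subseteq> M \<longleftrightarrow> (\<forall>m. m \<notin> M \<longrightarrow> Poly_Mapping.lookup f m = 0)"
  by (auto simp: in_keys_iff subset_iff)

lemma keys_mon_poly [simp]: "Poly_Mapping.keys (mon_poly m :: ('k::comm_ring_1, 'n) mpoly) = {m}"
  by (simp add: mon_poly_def)

lemma mp_span_mon_poly:
  "mp_span (mon_poly ` M) = {f :: ('k::field, 'n) mpoly. Poly_Mapping.keys f \<subseteq> M}"
proof
  show "mp_span (mon_poly ` M) \<subseteq> {f :: ('k, 'n) mpoly. Poly_Mapping.keys f \<subseteq> M}"
  proof (rule mp.span_minimal)
    show "mp.subspace {f :: ('k, 'n) mpoly. Poly_Mapping.keys f \<subseteq> M}"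
      by (rule mp.subspaceI) (simp_all add: keys_subset_iff lookup_add lookup_const_mult)
  qed auto
  show "{f :: ('k, 'n) mpoly. Poly_Mapping.keys f \<subseteq> M} \<subseteq> mp_span (mon_poly ` M)"
  proof
    fix f :: "('k, 'n) mpoly" assume "f \<in> {f. Poly_Mapping.keys f \<subseteq> M}"
    then have "(\<Sum>m\<in>Poly_Mapping.keys f. const (Poly_Mapping.lookup f m) * mon_poly m)
        \<in> mp_span (mon_poly ` M)"
      by (intro mp.span_sum mp.span_scale mp.span_base) auto
    then show "f \<in> mp_span (mon_poly ` M)"
      using mpoly_eq_sum_mon_poly[of f] by simp
  qed
qed

lemma is_ideal_monomial:
  assumes "\<And>a m. m \<in> M \<Longrightarrow> a + m \<in> M"
  shows "is_ideal {f :: ('k::comm_ring_1, 'n) mpoly. Poly_Mapping.keys f \<subseteq> M}"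
proof (rule mp_ideal.subspaceI)
  fix c f :: "('k, 'n) mpoly"
  assume "f \<in> {f. Poly_Mapping.keys f \<subseteq> M}"
  then show "c * f \<in> {f. Poly_Mapping.keys f \<subseteq> M}"
    using keys_mult[of c f] assms by blast
qed (simp_all add: keys_subset_iff lookup_add)

lemma ideal_span_mon_poly:
  assumes "\<And>a m. m \<in> M \<Longrightarrow> a + m \<in> M"
  shows "ideal_span (mon_poly ` M) = {f :: ('k::comm_ring_1, 'n) mpoly. Poly_Mapping.keys f \<subseteq> M}"
proof
  show "ideal_span (mon_poly ` M) \<subseteq> {f :: ('k, 'n) mpoly. Poly_Mapping.keys f \<subseteq> M}"
    by (rule mp_ideal.span_minimal) (auto intro: is_ideal_monomial assms)
  show "{f :: ('k, 'n) mpoly. Poly_Mapping.keys f \<subseteq> M} \<subseteq> ideal_span (mon_poly ` M)"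
  proof
    fix f :: "('k, 'n) mpoly" assume "f \<in> {f. Poly_Mapping.keys f \<subseteq> M}"
    then have "(\<Sum>m\<in>Poly_Mapping.keys f. const (Poly_Mapping.lookup f m) * mon_poly m)
        \<in> ideal_span (mon_poly ` M)"
      by (intro mp_ideal.span_sum mp_ideal.span_scale mp_ideal.span_base) auto
    then show "f \<in> ideal_span (mon_poly ` M)"
      using mpoly_eq_sum_mon_poly[of f] by simp
  qed
qed

section \<open>Independence of the low monomials in every degree\<close>

lemma indep_on_subset:
  assumes "indep_on w N" "finite N" "M \<subseteq> N"
  shows "indep_on w M"
  unfolding indep_on_def
proof (intro allI impI)
  fix c assume c: "\<forall>i. (\<Sum>m\<in>M. c m * mon_eval (w i) m) = 0"
  let ?c = "\<lambda>m. if m \<in> M then c m else 0"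
  have "(\<Sum>m\<in>N. ?c m * mon_eval (w i) m) = (\<Sum>m\<in>M. c m * mon_eval (w i) m)" for i
    using assms by (intro sum.mono_neutral_cong_right) auto
  then have "\<forall>m\<in>N. ?c m = 0"
    using assms(1)[unfolded indep_on_def, rule_format, of ?c] c by simp
  then show "\<forall>m\<in>M. c m = 0"
    using assms(3) by (metis subsetD)
qed

lemma indep_on_shift:
  assumes "indep_on w M" "\<And>i. mon_eval (w i) a \<noteq> 0"
  shows "indep_on w ((+) a ` M)"
  unfolding indep_on_def
proof (intro allI impI)
  fix c assume c: "\<forall>i. (\<Sum>m\<in>(+) a ` M. c m * mon_eval (w i) m) = 0"
  have "mon_eval (w i) a * (\<Sum>m\<in>M. c (a + m) * mon_eval (w i) m) = 0" for i
    using c[rule_format, of i]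
    by (simp add: sum.reindex mon_eval_add sum_distrib_left ac_simps)
  then have "(\<Sum>m\<in>M. c (a + m) * mon_eval (w i) m) = 0" for i
    using assms(2) by simp
  then show "\<forall>m\<in>(+) a ` M. c m = 0"
    using assms(1)[unfolded indep_on_def, rule_format, of "\<lambda>m. c (a + m)"] by simp
qed

text \<open>Above degree \<open>s\<close> the low monomials are multiples by the last variable of low monomials of
  degree one less, and multiplication by a variable that vanishes at none of the points preserves
  independence. So finitely many open conditions control all degrees.\<close>

lemma indep_on_low_mons_all_degrees:
  fixes \<tau> :: "'n::{finite,linorder} mon rel" and w :: "'s::finite \<Rightarrow> 'n \<Rightarrow> 'k::field"
  assumes \<tau>: "term_order \<tau>" "vars_decreasing \<tau>" and z: "\<And>i. i \<le> z"
    and wz: "\<And>i. w i z \<noteq> 0"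
    and small: "\<And>d. d \<le> s \<Longrightarrow> indep_on w (low_mons \<tau> s d)"
  shows "indep_on w (low_mons \<tau> s d)"
proof (induction d)
  case (Suc d)
  show ?case
  proof (cases "Suc d \<le> s")
    case False
    then have "low_mons \<tau> s (Suc d) \<subseteq> (+) (Poly_Mapping.single z 1) ` low_mons \<tau> s d"
      using low_mons_divisible_by_last[OF \<tau> z, of s d] by auto
    moreover have "indep_on w ((+) (Poly_Mapping.single z 1) ` low_mons \<tau> s d)"
      by (rule indep_on_shift[OF Suc.IH]) (simp add: wz)
    ultimately show ?thesis
      by (rule indep_on_subset[rotated 2]) simp
  qed (rule small)
qed (rule small, simp)

text \<open>As many independent monomials as points make the evaluation matrix invertible.\<close>

lemma indep_on_interpolation:
  fixes w :: "'s::finite \<Rightarrow> 'n::finite \<Rightarrow> 'k::field"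
  assumes "indep_on w B" "finite B" "card B = CARD('s)"
  shows "\<exists>c. \<forall>i. (\<Sum>b\<in>B. c b * mon_eval (w i) b) = y i"
proof -
  obtain \<beta> :: "'s \<Rightarrow> 'n mon" where \<beta>: "bij_betw \<beta> UNIV B"
    using finite_same_card_bij[of "UNIV :: 's set" B] assms by auto
  define \<gamma> where "\<gamma> = the_inv \<beta>"
  have \<gamma>: "\<gamma> (\<beta> j) = j" for j
    using \<beta> by (simp add: \<gamma>_def bij_betw_def the_inv_f_f)
  define A :: "'k^'s^'s" where "A = (\<chi> i j. mon_eval (w i) (\<beta> j))"
  have row: "(A *v x) $ i = (\<Sum>b\<in>B. x $ \<gamma> b * mon_eval (w i) b)" for x i
    unfolding sum.reindex_bij_betw[OF \<beta>, symmetric]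
    by (simp add: A_def matrix_vector_mult_def \<gamma> mult.commute)
  have "x = 0" if x: "A *v x = 0" for x
  proof -
    have "(\<Sum>b\<in>B. x $ \<gamma> b * mon_eval (w i) b) = 0" for i
      using x row[of x i] by simp
    then have "\<forall>b\<in>B. x $ \<gamma> b = 0"
      using assms(1)[unfolded indep_on_def, rule_format, of "\<lambda>b. x $ \<gamma> b"] by blast
    then have "x $ j = 0" for j
      using \<beta> \<gamma>[of j] by (metis bij_betwE UNIV_I)
    then show ?thesis
      by (simp add: vec_eq_iff)
  qed
  then have "invertible A"
    by (simp add: invertible_det_nz det_nonzero_iff_ker)
  then obtain A' where "A ** A' = mat 1"
    unfolding invertible_def by blast
  then have "A *v (A' *v (\<chi> i. y i)) = (\<chi> i. y i)"
    by (simp add: matrix_vector_mul_assoc)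
  then have "(A *v (A' *v (\<chi> i. y i))) $ i = y i" for i
    by simp
  then show ?thesis
    unfolding row by (intro exI allI)
qed

section \<open>The initial ideal of points in general position\<close>

lemma forms_vanishing_iff:
  assumes "f \<in> forms d"
  shows "f \<in> vanishing_ideal w \<longleftrightarrow> (\<forall>i. meval (w i) f = 0)"
proof
  assume "f \<in> vanishing_ideal w"
  then have "meval (\<lambda>j. 1 * w i j) f = 0" for i
    unfolding vanishing_ideal_def by blast
  then show "\<forall>i. meval (w i) f = 0"
    by simp
qed (simp add: vanishing_ideal_def meval_scale_forms[OF assms])

context
  fixes \<tau> :: "'n::finite mon rel" and w :: "'s::finite \<Rightarrow> 'n \<Rightarrow> 'k::field_char_0"
  assumes \<tau>: "term_order \<tau>"
    and indep: "\<And>d. indep_on w (low_mons \<tau> CARD('s) d)"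
begin

lemma vanishing_low_eq_zero:
  assumes "f \<in> vanishing_ideal w" "Poly_Mapping.keys f \<subseteq> low_mons \<tau> CARD('s) d"
  shows "f = 0"
proof (rule poly_mapping_eqI)
  fix m
  have "f \<in> forms d"
    using assms(2) by (auto simp: forms_def dest: mdeg_low_mons)
  then have "meval (w i) f = 0" for i
    using assms(1) forms_vanishing_iff by blast
  then have "\<forall>m\<in>low_mons \<tau> CARD('s) d. Poly_Mapping.lookup f m = 0"
    using indep[of d] meval_eq_sum_superset[OF finite_low_mons assms(2)]
    unfolding indep_on_def by metis
  then show "Poly_Mapping.lookup f m = Poly_Mapping.lookup 0 m"
    using assms(2) by (auto simp: in_keys_iff subset_iff)
qed

text \<open>If there are high monomials, the \<open>s\<close> low ones interpolate any values on the points. Subtracting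
  the interpolation of \<open>m\<close> leaves a vanishing form with leading monomial \<open>m\<close>.\<close>

lemma reduced_form_exists:
  assumes m: "m \<in> high_mons \<tau> CARD('s) d"
  shows "\<exists>f \<in> vanishing_ideal w. Poly_Mapping.lookup f m = 1 \<and>
    Poly_Mapping.keys f \<subseteq> insert m (low_mons \<tau> CARD('s) d)"
proof -
  have "card (low_mons \<tau> CARD('s) d) = CARD('s)"
    using card_low_mons_eq[OF \<tau>] m by blast
  from indep_on_interpolation[OF indep finite_low_mons this, of "\<lambda>i. mon_eval (w i) m"]
  obtain c where
    c: "\<forall>i. (\<Sum>b\<in>low_mons \<tau> CARD('s) d. c b * mon_eval (w i) b) = mon_eval (w i) m"
    by (rule exE)
  define f where "f = mon_poly m - (\<Sum>b\<in>low_mons \<tau> CARD('s) d. Poly_Mapping.single b (c b))"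
  have lookup: "Poly_Mapping.lookup f k =
      (if k = m then 1 else 0) - (if k \<in> low_mons \<tau> CARD('s) d then c k else 0)" for k
    unfolding f_def
    by (simp add: lookup_minus lookup_sum mon_poly_def lookup_single when_def)
  have "m \<notin> low_mons \<tau> CARD('s) d"
    using m low_high_disjoint by blast
  then have "Poly_Mapping.lookup f m = 1"
    by (simp add: lookup)
  moreover have keys: "Poly_Mapping.keys f \<subseteq> insert m (low_mons \<tau> CARD('s) d)"
    by (auto simp: keys_subset_iff lookup)
  moreover have "f \<in> forms d"
    using keys m by (auto simp: forms_def dest: mdeg_low_mons mdeg_high_mons)
  then have "f \<in> vanishing_ideal w"
    by (simp add: forms_vanishing_iff f_def meval_diff meval_sum c)
  ultimately show ?thesis
    by blast
qed

text \<open>A vanishing form with low leading monomial would be a relation between the low monomials,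
  so leading monomials are high; the reduced forms show that every high monomial occurs.\<close>

lemma lead_mons_vanishing_ideal:
  "lead_mon \<tau> ` {f \<in> vanishing_ideal w. f \<noteq> 0} = (\<Union>d. high_mons \<tau> CARD('s) d)"
proof (intro equalityI subsetI)
  fix m assume "m \<in> lead_mon \<tau> ` {f \<in> vanishing_ideal w. f \<noteq> 0}"
  then obtain f where f: "f \<in> vanishing_ideal w" "f \<noteq> 0" "m = lead_mon \<tau> f"
    by blast
  note lead = lead_mon_greatest[OF \<tau> f(2), folded f(3)]
  have "m \<notin> low_mons \<tau> CARD('s) (mdeg m)"
  proof
    assume m: "m \<in> low_mons \<tau> CARD('s) (mdeg m)"
    have "Poly_Mapping.keys (hom_part (mdeg m) f) \<subseteq> low_mons \<tau> CARD('s) (mdeg m)"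
      using lead(2) m low_mons_downward[OF \<tau> m] by (auto simp: keys_hom_part mon_less_def)
    then have "hom_part (mdeg m) f = 0"
      using vanishing_low_eq_zero hom_part_in_vanishing_ideal[OF f(1)] by blast
    moreover have "m \<in> Poly_Mapping.keys (hom_part (mdeg m) f)"
      using lead(1) by (simp add: keys_hom_part)
    ultimately show False
      by simp
  qed
  then show "m \<in> (\<Union>d. high_mons \<tau> CARD('s) d)"
    by (auto simp: high_mons_def)
next
  fix m assume "m \<in> (\<Union>d. high_mons \<tau> CARD('s) d)"
  then obtain d where m: "m \<in> high_mons \<tau> CARD('s) d"
    by blast
  then obtain f where f: "f \<in> vanishing_ideal w" "Poly_Mapping.lookup f m = 1"
    "Poly_Mapping.keys f \<subseteq> insert m (low_mons \<tau> CARD('s) d)"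
    using reduced_form_exists by blast
  have "f \<noteq> 0"
    using f(2) by auto
  moreover have "lead_mon \<tau> f = m"
  proof (rule lead_mon_eqI[OF \<tau>])
    show "m \<in> Poly_Mapping.keys f"
      using f(2) by (simp add: in_keys_iff)
    show "(m', m) \<in> \<tau>" if "m' \<in> Poly_Mapping.keys f" for m'
      using that f(3) low_less_high[OF \<tau> _ m] term_order_total[OF \<tau>, of m m]
      by (auto simp: mon_less_def)
  qed
  ultimately show "m \<in> lead_mon \<tau> ` {f \<in> vanishing_ideal w. f \<noteq> 0}"
    using f(1) by blast
qed

lemma high_mons_Union_add: "m \<in> (\<Union>d. high_mons \<tau> CARD('s) d) \<Longrightarrow> a + m \<in> (\<Union>d. high_mons \<tau> CARD('s) d)"
  using high_mons_add[OF \<tau>] by blast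

lemma initial_ideal_vanishing_ideal:
  "initial_ideal \<tau> (vanishing_ideal w) = {f. Poly_Mapping.keys f \<subseteq> (\<Union>d. high_mons \<tau> CARD('s) d)}"
proof -
  have "({mon_poly (lead_mon \<tau> f) |f. f \<in> vanishing_ideal w \<and> f \<noteq> 0} :: ('k, 'n) mpoly set) =
      mon_poly ` lead_mon \<tau> ` {f \<in> vanishing_ideal w. f \<noteq> 0}"
    by blast
  then show ?thesis
    unfolding initial_ideal_def lead_mons_vanishing_ideal
    using ideal_span_mon_poly[of "\<Union>d. high_mons \<tau> CARD('s) d", OF high_mons_Union_add] by simp
qed

text \<open>The reduced forms are a basis: each has its own high monomial with coefficient 1, and after
  subtracting the right combination of them a vanishing form has only low monomials left.\<close>

lemma dim_vanishing_forms: "mp_dim (ideal_comp (vanishing_ideal w) d) = card (high_mons \<tau> CARD('s) d)"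
proof -
  let ?V = "ideal_comp (vanishing_ideal w) d"
  have "\<forall>m\<in>high_mons \<tau> CARD('s) d. \<exists>f. f \<in> vanishing_ideal w \<and>
      Poly_Mapping.lookup f m = 1 \<and> Poly_Mapping.keys f \<subseteq> insert m (low_mons \<tau> CARD('s) d)"
    using reduced_form_exists[of _ d] by blast
  from bchoice[OF this] obtain r where
    "\<forall>m\<in>high_mons \<tau> CARD('s) d. r m \<in> vanishing_ideal w \<and>
      Poly_Mapping.lookup (r m) m = 1 \<and> Poly_Mapping.keys (r m) \<subseteq> insert m (low_mons \<tau> CARD('s) d)"
    by (rule exE)
  then have r: "r m \<in> vanishing_ideal w" "Poly_Mapping.lookup (r m) m = 1"
    "Poly_Mapping.keys (r m) \<subseteq> insert m (low_mons \<tau> CARD('s) d)" if "m \<in> high_mons \<tau> CARD('s) d" for m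
    using that by blast+
  have lookup_r: "Poly_Mapping.lookup (r m) k = (if k = m then 1 else 0)"
    if "m \<in> high_mons \<tau> CARD('s) d" "k \<notin> low_mons \<tau> CARD('s) d" for m k
    using r(2,3)[OF that(1)] that(2) by (auto simp: keys_subset_iff)
  have notlow: "m \<notin> low_mons \<tau> CARD('s) d" if "m \<in> high_mons \<tau> CARD('s) d" for m
    using that low_high_disjoint by blast
  have lookup_sum_r: "Poly_Mapping.lookup (\<Sum>m\<in>high_mons \<tau> CARD('s) d. const (c m) * r m) k =
      (if k \<in> high_mons \<tau> CARD('s) d then c k else 0)" if "k \<notin> low_mons \<tau> CARD('s) d" for c k
  proof -
    have "Poly_Mapping.lookup (\<Sum>m\<in>high_mons \<tau> CARD('s) d. const (c m) * r m) k =
        (\<Sum>m\<in>high_mons \<tau> CARD('s) d. if k = m then c m else 0)"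
      unfolding lookup_sum using that
      by (intro sum.cong) (auto simp: lookup_const_mult lookup_r)
    then show ?thesis
      by simp
  qed
  have inj: "inj_on r (high_mons \<tau> CARD('s) d)"
    by (rule inj_onI) (metis lookup_r notlow zero_neq_one)
  show ?thesis
  proof (rule mp.dim_unique)
    show "r ` high_mons \<tau> CARD('s) d \<subseteq> ?V"
      using r(1,3) by (fastforce simp: ideal_comp_def forms_def dest: mdeg_low_mons mdeg_high_mons)
    show "?V \<subseteq> mp.span (r ` high_mons \<tau> CARD('s) d)"
    proof
      fix f assume f: "f \<in> ?V"
      define g where "g = (\<Sum>m\<in>high_mons \<tau> CARD('s) d. const (Poly_Mapping.lookup f m) * r m)"
      have "f - g \<in> vanishing_ideal w"
        using f r(1) unfolding g_def ideal_comp_def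
        by (intro mp_ideal.subspace_diff mp_ideal.subspace_sum mp_ideal.subspace_scale
            is_ideal_vanishing_ideal) auto
      moreover have "Poly_Mapping.keys (f - g) \<subseteq> low_mons \<tau> CARD('s) d"
        unfolding keys_subset_iff
      proof (intro allI impI)
        fix k assume k: "k \<notin> low_mons \<tau> CARD('s) d"
        have "Poly_Mapping.lookup f k = 0" if "k \<notin> high_mons \<tau> CARD('s) d"
        proof -
          have "mdeg k \<noteq> d"
            using k that by (auto simp: high_mons_def)
          then show ?thesis
            using f by (auto simp: ideal_comp_def forms_def in_keys_iff)
        qed
        then show "Poly_Mapping.lookup (f - g) k = 0"
          using k by (simp add: lookup_minus g_def lookup_sum_r)
      qed
      ultimately have "f - g = 0"
        by (rule vanishing_low_eq_zero)
      moreover have "g \<in> mp.span (r ` high_mons \<tau> CARD('s) d)"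
        unfolding g_def by (intro mp.span_sum mp.span_scale mp.span_base) auto
      ultimately show "f \<in> mp.span (r ` high_mons \<tau> CARD('s) d)"
        by simp
    qed
    show "mp.independent (r ` high_mons \<tau> CARD('s) d)"
    proof (rule mp.independent_if_scalars_zero)
      fix c x assume c: "(\<Sum>x\<in>r ` high_mons \<tau> CARD('s) d. const (c x) * x) = 0" and x: "x \<in> r ` high_mons \<tau> CARD('s) d"
      obtain m where m: "m \<in> high_mons \<tau> CARD('s) d" "x = r m"
        using x by blast
      have "(\<Sum>m\<in>high_mons \<tau> CARD('s) d. const (c (r m)) * r m) = 0"
        using c by (simp add: sum.reindex[OF inj])
      then show "c x = 0"
        using lookup_sum_r[OF notlow[OF m(1)], of "\<lambda>m. c (r m)"] m by simp
    qed simp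
    show "card (r ` high_mons \<tau> CARD('s) d) = card (high_mons \<tau> CARD('s) d)"
      by (rule card_image[OF inj])
  qed
qed

lemma Seg_vanishing_ideal:
  "Seg \<tau> d (mp_dim (ideal_comp (vanishing_ideal w) d)) = mp_span (mon_poly ` high_mons \<tau> CARD('s) d)"
  unfolding Seg_def dim_vanishing_forms using high_mons_eq_top[OF \<tau>, of "CARD('s)" d] by simp

lemma Seg_ideal_vanishing_ideal:
  "Seg_ideal \<tau> (vanishing_ideal w) = {f. Poly_Mapping.keys f \<subseteq> (\<Union>d. high_mons \<tau> CARD('s) d)}"
proof -
  have "mp_span (\<Union>d. mp_span (mon_poly ` high_mons \<tau> CARD('s) d) :: ('k, 'n) mpoly set) =
      mp_span (mon_poly ` (\<Union>d. high_mons \<tau> CARD('s) d))"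
  proof (rule mp.span_eq[THEN iffD2], intro conjI)
    show "(\<Union>d. mp_span (mon_poly ` high_mons \<tau> CARD('s) d) :: ('k, 'n) mpoly set)
        \<subseteq> mp_span (mon_poly ` (\<Union>d. high_mons \<tau> CARD('s) d))"
      unfolding mp_span_mon_poly by blast
    show "mon_poly ` (\<Union>d. high_mons \<tau> CARD('s) d) \<subseteq> mp_span (\<Union>d. mp_span (mon_poly ` high_mons \<tau> CARD('s) d) :: ('k, 'n) mpoly set)"
      by (auto intro!: mp.span_base)
  qed
  then show ?thesis
    by (simp only: Seg_ideal_def Seg_vanishing_ideal mp_span_mon_poly)
qed

lemma segment_ideal_Seg_ideal: "segment_ideal \<tau> (Seg_ideal \<tau> (vanishing_ideal w))"
proof -
  let ?H = "\<Union>d. high_mons \<tau> CARD('s) d"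
  let ?I = "{f :: ('k, 'n) mpoly. Poly_Mapping.keys f \<subseteq> ?H}"
  have ideal: "is_ideal ?I"
    by (rule is_ideal_monomial) (rule high_mons_Union_add)
  have "?I = ideal_span (mon_poly ` ?H)"
    by (rule ideal_span_mon_poly[symmetric]) (rule high_mons_Union_add)
  also have "\<dots> \<subseteq> ideal_span (?I \<inter> (\<Union>d. forms d))"
    by (intro mp_ideal.span_mono) (auto simp: forms_def mon_poly_def)
  finally have "?I \<subseteq> ideal_span (?I \<inter> (\<Union>d. forms d))" .
  moreover have "ideal_span (?I \<inter> (\<Union>d. forms d)) \<subseteq> ?I"
    by (rule mp_ideal.span_minimal[OF Int_lower1 ideal])
  ultimately have "homogeneous_ideal ?I"
    unfolding homogeneous_ideal_def using ideal by (intro conjI equalityI)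
  moreover have "is_segment \<tau> d (ideal_comp ?I d)" for d
  proof -
    have eq: "ideal_comp ?I d = mp_span (mon_poly ` high_mons \<tau> CARD('s) d)"
    proof -
      have "m \<in> ?H \<and> mdeg m = d \<longleftrightarrow> m \<in> high_mons \<tau> CARD('s) d" for m
        by (auto dest: mdeg_high_mons)
      then show ?thesis
        unfolding mp_span_mon_poly ideal_comp_def forms_def by blast
    qed
    moreover have "high_mons \<tau> CARD('s) d \<subseteq> {m. mdeg m = d}"
      by (auto dest: mdeg_high_mons)
    moreover have "mon_poly m' \<in> ideal_comp ?I d"
      if "mon_poly m \<in> ideal_comp ?I d" "mdeg m' = d" "mon_less \<tau> m m'" for m m'
      using that high_mons_upward[OF \<tau>] unfolding eq mp_span_mon_poly by simp
    ultimately show ?thesis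
      unfolding is_segment_def by blast
  qed
  ultimately show ?thesis
    unfolding Seg_ideal_vanishing_ideal segment_ideal_def by blast
qed

end

section \<open>The lexicographic order\<close>

lemma lex_first_difference:
  fixes a b :: "'n::{finite,linorder} mon"
  assumes "a \<noteq> b"
  shows "\<exists>i. Poly_Mapping.lookup a i \<noteq> Poly_Mapping.lookup b i \<and>
    (\<forall>j<i. Poly_Mapping.lookup a j = Poly_Mapping.lookup b j)"
proof -
  let ?D = "{i. Poly_Mapping.lookup a i \<noteq> Poly_Mapping.lookup b i}"
  have "?D \<noteq> {}"
    using assms poly_mapping_eqI[of a b] by blast
  then have "Min ?D \<in> ?D"
    by (intro Min_in) auto
  then have "Poly_Mapping.lookup a (Min ?D) \<noteq> Poly_Mapping.lookup b (Min ?D)"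
    by blast
  moreover have "Poly_Mapping.lookup a j = Poly_Mapping.lookup b j" if "j < Min ?D" for j
  proof (rule ccontr)
    assume "Poly_Mapping.lookup a j \<noteq> Poly_Mapping.lookup b j"
    then have "Min ?D \<le> j"
      by (intro Min_le) simp_all
    with that show False
      by simp
  qed
  ultimately show ?thesis
    by (intro exI[of _ "Min ?D"] conjI allI impI)
qed

lemma trans_lex_order: "trans (lex_order :: 'n::{finite,linorder} mon rel)"
proof (rule transI)
  fix a b c :: "'n mon"
  assume ab: "(a, b) \<in> lex_order" and bc: "(b, c) \<in> lex_order"
  let ?l = "\<lambda>a b. \<exists>i. Poly_Mapping.lookup a i < Poly_Mapping.lookup b i \<and>
    (\<forall>j<i. Poly_Mapping.lookup a j = Poly_Mapping.lookup b j)"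
  have "?l a c" if l: "?l a b" "?l b c"
  proof -
    obtain i where i: "Poly_Mapping.lookup a i < Poly_Mapping.lookup b i"
      "\<forall>j<i. Poly_Mapping.lookup a j = Poly_Mapping.lookup b j"
      using l(1) by blast
    obtain k where k: "Poly_Mapping.lookup b k < Poly_Mapping.lookup c k"
      "\<forall>j<k. Poly_Mapping.lookup b j = Poly_Mapping.lookup c j"
      using l(2) by blast
    show ?thesis
    proof (rule exI[of _ "min i k"], intro conjI allI impI)
      show "Poly_Mapping.lookup a (min i k) < Poly_Mapping.lookup c (min i k)"
        using i k by (cases i k rule: linorder_cases) auto
      show "Poly_Mapping.lookup a j = Poly_Mapping.lookup c j" if "j < min i k" for j
        using i k that by simp
    qed
  qed
  then show "(a, c) \<in> lex_order"
    using ab bc unfolding lex_order_def by auto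
qed

lemma antisym_lex_order: "antisym (lex_order :: 'n::{finite,linorder} mon rel)"
proof (rule antisymI)
  fix a b :: "'n mon"
  assume ab: "(a, b) \<in> lex_order" and ba: "(b, a) \<in> lex_order"
  show "a = b"
  proof (rule ccontr)
    assume "a \<noteq> b"
    then have eq: "mdeg a = mdeg b"
      using ab ba unfolding lex_order_def by auto
    obtain i where i: "Poly_Mapping.lookup a i < Poly_Mapping.lookup b i"
      "\<forall>j<i. Poly_Mapping.lookup a j = Poly_Mapping.lookup b j"
      using ab \<open>a \<noteq> b\<close> eq unfolding lex_order_def by auto
    obtain k where k: "Poly_Mapping.lookup b k < Poly_Mapping.lookup a k"
      "\<forall>j<k. Poly_Mapping.lookup b j = Poly_Mapping.lookup a j"
      using ba \<open>a \<noteq> b\<close> eq unfolding lex_order_def by auto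
    show False
      using i(1) k(1) i(2)[rule_format, of k] k(2)[rule_format, of i]
      by (cases i k rule: linorder_cases) simp_all
  qed
qed

lemma total_lex_order: "(a, b) \<in> lex_order \<or> (b, a) \<in> (lex_order :: 'n::{finite,linorder} mon rel)"
proof (cases "a \<noteq> b \<and> mdeg a = mdeg b")
  case True
  then obtain i where i: "Poly_Mapping.lookup a i \<noteq> Poly_Mapping.lookup b i"
    "\<And>j. j < i \<Longrightarrow> Poly_Mapping.lookup a j = Poly_Mapping.lookup b j"
    using lex_first_difference[of a b] by blast
  show ?thesis
  proof (cases "Poly_Mapping.lookup a i < Poly_Mapping.lookup b i")
    case True
    with i have "(a, b) \<in> lex_order"
      using \<open>a \<noteq> b \<and> mdeg a = mdeg b\<close> unfolding lex_order_def by blast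
    then show ?thesis ..
  next
    case False
    with i have "Poly_Mapping.lookup b i < Poly_Mapping.lookup a i"
      "\<forall>j<i. Poly_Mapping.lookup b j = Poly_Mapping.lookup a j"
      by auto
    then have "(b, a) \<in> lex_order"
      using \<open>a \<noteq> b \<and> mdeg a = mdeg b\<close> unfolding lex_order_def by auto
    then show ?thesis ..
  qed
qed (auto simp: lex_order_def)

text \<open>Degree compatibility leaves only finitely many monomials below any given one, and their
  number decreases strictly along the order.\<close>

lemma wf_lex_order: "wf ((lex_order :: 'n::{finite,linorder} mon rel) - Id)"
proof -
  let ?below = "\<lambda>m :: 'n mon. {m'. (m', m) \<in> lex_order \<and> m' \<noteq> m}"
  have finite: "finite (?below m)" for m
  proof (rule finite_subset)
    show "?below m \<subseteq> (\<Union>d\<le>mdeg m. {m'. mdeg m' = d})"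
      by (auto simp: lex_order_def)
  qed (simp add: finite_mdeg)
  have "(lex_order :: 'n mon rel) - Id \<subseteq> measure (\<lambda>m. card (?below m))"
  proof
    fix p assume "p \<in> (lex_order :: 'n mon rel) - Id"
    then obtain a b where p: "p = (a, b)" "(a, b) \<in> lex_order" "a \<noteq> b"
      by (cases p) auto
    have "?below a \<subset> ?below b"
    proof
      show "?below a \<subseteq> ?below b"
        using p transD[OF trans_lex_order] antisymD[OF antisym_lex_order] by blast
      show "?below a \<noteq> ?below b"
        using p by blast
    qed
    then show "p \<in> measure (\<lambda>m. card (?below m))"
      using p(1) psubset_card_mono[OF finite] by simp
  qed
  then show ?thesis
    by (rule wf_subset[OF wf_measure])
qed

lemma term_order_lex_order: "term_order (lex_order :: 'n::{finite,linorder} mon rel)"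
  unfolding term_order_def
proof (intro conjI allI impI)
  have "refl_on UNIV (lex_order :: 'n mon rel)"
    by (auto simp: refl_on_def lex_order_def)
  then show "well_order (lex_order :: 'n mon rel)"
    unfolding order_on_defs total_on_def
    by (intro conjI ballI impI trans_lex_order antisym_lex_order total_lex_order wf_lex_order)
      simp_all
  show "(a + c, b + c) \<in> lex_order" if "(a, b) \<in> lex_order" for a b c :: "'n mon"
    using that unfolding lex_order_def by (auto simp: mdeg_add lookup_add)
  show "(a, b) \<in> lex_order" if "mdeg a < mdeg b" for a b :: "'n mon"
    using that unfolding lex_order_def by blast
qed

lemma vars_decreasing_lex_order: "vars_decreasing (lex_order :: 'n::{finite,linorder} mon rel)"
  unfolding vars_decreasing_def
proof (intro allI impI)
  fix i j :: 'n assume ij: "i < j"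
  let ?x = "\<lambda>i :: 'n. Poly_Mapping.single i (1 :: nat)"
  have "Poly_Mapping.lookup (?x j) i < Poly_Mapping.lookup (?x i) i"
    "\<forall>l<i. Poly_Mapping.lookup (?x j) l = Poly_Mapping.lookup (?x i) l"
    using ij by (auto simp: lookup_single when_def)
  moreover from this have "?x j \<noteq> ?x i"
    by auto
  moreover have "mdeg (?x j) = mdeg (?x i)"
    by simp
  ultimately show "mon_less lex_order (?x j) (?x i)"
    unfolding mon_less_def lex_order_def by blast
qed

section \<open>Generic coordinates and generic points\<close>

text \<open>A nonempty open set of matrices contains a point where the determinant times some polynomial
  does not vanish, and such a function has a common nonvanishing point with \<open>G\<close>.\<close>

lemma gl_dense_nonvanishing:
  fixes G :: "('k::field_char_0, 'n::finite \<times> 'n) mpoly"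
  assumes "meval x1 G \<noteq> 0"
  shows "gl_dense {g :: 'k^'n^'n. invertible g \<and> meval (\<lambda>(i, j). g $ i $ j) G \<noteq> 0}"
  unfolding gl_dense_def
proof (intro allI impI)
  fix W :: "('k^'n^'n) set" assume W: "gl_open W \<and> W \<noteq> {}"
  then obtain F where F: "W = {g. invertible g \<and> (\<exists>f\<in>F. meval (\<lambda>(i, j). g $ i $ j) f \<noteq> 0)}"
    unfolding gl_open_def by blast
  then obtain g0 f where g0: "invertible g0" "f \<in> F" "meval (\<lambda>(i, j). g0 $ i $ j) f \<noteq> 0"
    using W by blast
  define \<delta> where "\<delta> = (\<lambda>x :: 'n \<times> 'n \<Rightarrow> 'k. det (\<chi> i j. x (i, j)))"
  have \<delta>: "poly_fun UNIV \<delta>"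
    unfolding \<delta>_def by (rule poly_fun_UNIV_det) (simp add: poly_fun_coord)
  have f: "poly_fun UNIV (\<lambda>x. meval x f)" and G: "poly_fun UNIV (\<lambda>x. meval x G)"
    by (rule poly_fun_meval, simp)+
  have \<delta>f: "poly_fun UNIV (\<lambda>x. \<delta> x * meval x f)"
    by (rule poly_fun_UNIV_mult[OF \<delta> f])
  have "\<delta> (\<lambda>(i, j). g0 $ i $ j) \<noteq> 0"
    using g0(1) by (simp add: \<delta>_def invertible_det_nz)
  then have "\<exists>x. \<delta> x * meval x f \<noteq> 0 \<and> meval x G \<noteq> 0"
    by (intro poly_fun_common_nonzero[OF \<delta>f G _ assms, of "\<lambda>(i, j). g0 $ i $ j"])
      (simp add: g0(3))
  then obtain x where x: "\<delta> x * meval x f \<noteq> 0 \<and> meval x G \<noteq> 0"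
    by (rule exE)
  define g :: "'k^'n^'n" where "g = (\<chi> i j. x (i, j))"
  have g: "(\<lambda>(i, j). g $ i $ j) = x"
    by (auto simp: g_def)
  have "invertible g"
    using x by (auto simp: g_def \<delta>_def invertible_det_nz)
  then show "{g. invertible g \<and> meval (\<lambda>(i, j). g $ i $ j) G \<noteq> 0} \<inter> W \<noteq> {}"
    using x g0(2) F g by auto
qed

text \<open>Changing coordinates by \<open>g\<close> only moves the points. The moved points satisfy the condition
  \<open>F \<noteq> 0\<close> for all \<open>g\<close> in an open set, which is dense because it contains the identity.\<close>

lemma is_gin_vanishing_ideal:
  fixes F :: "('k::field_char_0, 's::finite \<times> 'n::finite) mpoly" and v :: "'s \<Rightarrow> 'k^'n"
  assumes v: "meval (\<lambda>(i, j). v i $ j) F \<noteq> 0"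
    and init: "\<And>w. meval (\<lambda>(i, j). w i j) F \<noteq> 0 \<Longrightarrow> initial_ideal \<tau> (vanishing_ideal w) = J"
  shows "is_gin \<tau> (vanishing_ideal (\<lambda>i. ($) (v i))) J"
proof -
  have "poly_fun UNIV (\<lambda>x. meval (\<lambda>p. moved_point (\<chi> i j. x (i, j)) (v (fst p)) (snd p)) F)"
    by (rule poly_fun_compose[OF poly_fun_meval[OF order_refl] poly_fun_moved_point])
  then have "\<exists>G :: ('k, 'n \<times> 'n) mpoly. Poly_Mapping.keys G \<subseteq> UNIV \<and> (\<forall>x.
      meval (\<lambda>p. moved_point (\<chi> i j. x (i, j)) (v (fst p)) (snd p)) F = meval x G)"
    unfolding poly_fun_def .
  then obtain G :: "('k, 'n \<times> 'n) mpoly" where G: "Poly_Mapping.keys G \<subseteq> UNIV \<and> (\<forall>x.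
      meval (\<lambda>p. moved_point (\<chi> i j. x (i, j)) (v (fst p)) (snd p)) F = meval x G)"
    by (rule exE)
  have G_eq: "meval (\<lambda>(i, j). g $ i $ j) G = meval (\<lambda>(i, j). moved_point g (v i) j) F"
    for g :: "'k^'n^'n"
    using G[THEN conjunct2, rule_format, of "\<lambda>(i, j). g $ i $ j"]
    by (simp add: case_prod_unfold)
  let ?U = "{g :: 'k^'n^'n. invertible g \<and> meval (\<lambda>(i, j). g $ i $ j) G \<noteq> 0}"
  have "gl_open ?U"
    unfolding gl_open_def by (rule exI[of _ "{G}"]) simp
  moreover have "gl_dense ?U"
    by (rule gl_dense_nonvanishing[of "\<lambda>(i, j). mat 1 $ i $ j"])
      (simp add: G_eq moved_point_mat_1 v)
  moreover have "initial_ideal \<tau> (gl_act g ` vanishing_ideal (\<lambda>i. ($) (v i))) = J"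
    if "g \<in> ?U" for g
    using that by (simp add: gl_act_vanishing_ideal G_eq init)
  ultimately show ?thesis
    unfolding is_gin_def by blast
qed

theorem theorem1p2:
  shows "\<exists>U :: ('s::finite \<Rightarrow> ('k::{alg_closed_field,field_char_0}, 'n::{finite,linorder}) proj) set.
    zariski_open U \<and> U \<noteq> {} \<and>
    (\<forall>P\<in>U.
      (\<forall>\<tau>. term_order \<tau> \<and> vars_decreasing \<tau> \<longrightarrow>
        segment_ideal \<tau> (Seg_ideal \<tau> (points_ideal P)) \<and>
        gin \<tau> (points_ideal P) = Seg_ideal \<tau> (points_ideal P)) \<and>
      segment_ideal lex_order (gin lex_order (points_ideal P)))"
proof -
  \<comment> \<open>The index of the smallest variable.\<close>
  define z :: 'n where "z = Max UNIV"
  have z: "i \<le> z" for i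
    unfolding z_def by (rule Max_ge) simp_all
  obtain F :: "('k, 's \<times> 'n) mpoly" where F: "multihomogeneous F" "\<exists>x. meval x F \<noteq> 0"
    and generic: "\<forall>x. meval x F \<noteq> 0 \<longrightarrow> (\<forall>i. x (i, z) \<noteq> 0) \<and>
      (\<forall>d\<le>CARD('s). \<forall>M\<subseteq>{m. mdeg m = d}. card M \<le> CARD('s) \<longrightarrow> indep_on (\<lambda>i j. x (i, j)) M)"
    using generic_points_polynomial[of z "CARD('s)"] by blast
  have indep: "indep_on w (low_mons \<tau> CARD('s) d)"
    if "meval (\<lambda>(i, j). w i j) F \<noteq> 0" "term_order \<tau>" "vars_decreasing \<tau>" for w \<tau> d
  proof (rule indep_on_low_mons_all_degrees[OF that(2,3) z])
    show "w i z \<noteq> 0" for i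
      using generic[rule_format, OF that(1)] by simp
    show "indep_on w (low_mons \<tau> CARD('s) d)" if "d \<le> CARD('s)" for d
    proof -
      have "low_mons \<tau> CARD('s) d \<subseteq> {m. mdeg m = d}"
        by (auto dest: mdeg_low_mons)
      then show ?thesis
        using generic[rule_format, OF \<open>meval (\<lambda>(i, j). w i j) F \<noteq> 0\<close>] that
          card_low_mons_le[OF \<open>term_order \<tau>\<close>] by auto
    qed
  qed
  define U where "U = {P :: 's \<Rightarrow> ('k, 'n) proj. \<not> mvanishes F P}"
  have "zariski_open U"
    unfolding zariski_open_def U_def by (rule exI[of _ "{F}"]) (simp add: F(1))
  moreover have "U \<noteq> {}"
  proof -
    obtain x where x: "meval x F \<noteq> 0"
      using F(2) by blast
    define v :: "'s \<Rightarrow> ('k, 'n) vec" where "v = (\<lambda>i. \<chi> j. x (i, j))"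
    have "v i $ z \<noteq> 0" for i
      using generic x by (simp add: v_def)
    then have nz: "v i \<noteq> 0" for i
      by (metis zero_index)
    define P where "P = (\<lambda>i. Abs_proj (vec.span {v i}))"
    have "Rep_proj (P i) = vec.span {v i}" for i
      unfolding P_def by (rule Abs_proj_inverse) (use nz in blast)
    then have "v i \<in> hom_coords (P i)" for i
      by (simp add: hom_coords_def nz vec.span_base)
    moreover have "(\<lambda>(i, j). v i $ j) = x"
      by (auto simp: v_def)
    ultimately have "P \<in> U"
      using x unfolding U_def mvanishes_def by auto
    then show ?thesis
      by blast
  qed
  moreover have main: "segment_ideal \<tau> (Seg_ideal \<tau> (points_ideal P)) \<and>
      gin \<tau> (points_ideal P) = Seg_ideal \<tau> (points_ideal P)"
    if P: "P \<in> U" and \<tau>: "term_order \<tau>" "vars_decreasing \<tau>" for P \<tau>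
  proof -
    obtain v where v: "\<And>i. v i \<in> hom_coords (P i)" "meval (\<lambda>(i, j). v i $ j) F \<noteq> 0"
      using P unfolding U_def mvanishes_def by blast
    note I = points_ideal_eq[of v P, OF v(1)]
    note indep_v = indep[OF v(2) \<tau>]
    have "is_gin \<tau> (points_ideal P) (Seg_ideal \<tau> (points_ideal P))"
      unfolding I Seg_ideal_vanishing_ideal[OF \<tau>(1) indep_v]
      by (rule is_gin_vanishing_ideal[OF v(2)])
        (rule initial_ideal_vanishing_ideal[OF \<tau>(1) indep[OF _ \<tau>]])
    then show ?thesis
      using gin_eqI segment_ideal_Seg_ideal[OF \<tau>(1) indep_v] unfolding I by blast
  qed
  moreover have "segment_ideal lex_order (gin lex_order (points_ideal P))" if "P \<in> U" for P
    using main[OF that term_order_lex_order vars_decreasing_lex_order] by simp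
  ultimately show ?thesis
    by (intro exI[of _ U]) blast
qed

end
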